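(* Let $p,q$ be relatively prime positive integers, let $\omega_2=\sqrt{2+\sqrt2}$ and $T_2=2\pi/\omega_2$, and let $F_1,F_2:\mathbb{R}\times\mathbb{R}^4\to\mathbb{R}$ be smooth functions $F_k(\tau,\theta_1,\theta_1',\theta_2,\theta_2')$ that are periodic in $\tau$ of period $pT_2/q$. Consider the perturbed double pendulum $$\theta_1''=-2\theta_1+\theta_2+\varepsilon F_1(\tau,\theta_1,\theta_1',\theta_2,\theta_2'),\qquad \theta_2''=2\theta_1-2\theta_2+\varepsilon F_2(\tau,\theta_1,\theta_1',\theta_2,\theta_2'),$$ and let $\mathcal G^1,\mathcal G^2:\mathbb{R}^2\to\mathbb{R}$ be the functions defined in the context from $F_1,F_2$ and $p$. Then for $\varepsilon\neq0$ sufficiently small and for every simple zero $(Z_0^*,W_0^* )\neq(0,0)$ of the nonlinear system $\mathcal G^1(Z_0,W_0)=0$, $\mathcal G^2(Z_0,W_0)=0$, the perturbed double pendulum has a periodic solution $(\theta_1(\tau,\varepsilon),\theta_2(\tau,\varepsilon))$ tending when $\varepsilon\to0$ to the periodic solution $(\theta_1(\tau),\theta_2(\tau))$, run $p$ times, of the unperturbed double pendulum ($\varepsilon=0$) given by $$\theta_1(\tau)=-\frac{1}{\sqrt{4+2\sqrt2}}\bigl(Z_0^*\cos(\omega_2\tau)+W_0^*\sin(\omega_2\tau)\bigr),\qquad \theta_2(\tau)=\frac{1}{\sqrt{2+\sqrt2}}\bigl(Z_0^*\cos(\omega_2\tau)+W_0^*\sin(\omega_2\tau)\bigr).$$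
   Context: The prime denotes the derivative with respect to $\tau$, and $\varepsilon$ is a real parameter. The unperturbed double pendulum is $\theta_1''=-2\theta_1+\theta_2$, $\theta_2''=2\theta_1-2\theta_2$. With $\omega_2=\sqrt{2+\sqrt2}$ and $T_2=2\pi/\omega_2$, define $$\mathcal G^1(Z_0,W_0)=\int_0^{pT_2}\sin(\omega_2\tau)\bigl(-\sqrt2\,\bar F_1+\bar F_2\bigr)\,d\tau,\qquad \mathcal G^2(Z_0,W_0)=\int_0^{pT_2}\cos(\omega_2\tau)\bigl(-\sqrt2\,\bar F_1+\bar F_2\bigr)\,d\tau,$$ where the superscripts are indices, $\bar F_k=F_k(\tau,A_2,B_2,C_2,D_2)$ for $k=1,2$ and $$A_2=-\frac{1}{\sqrt{4+2\sqrt2}}\bigl(Z_0\cos(\omega_2\tau)+W_0\sin(\omega_2\tau)\bigr),\qquad B_2=\frac{1}{\sqrt2}\bigl(-W_0\cos(\omega_2\tau)+Z_0\sin(\omega_2\tau)\bigr),$$ $$C_2=\frac{1}{\sqrt{2+\sqrt2}}\bigl(Z_0\cos(\omega_2\tau)+W_0\sin(\omega_2\tau)\bigr),\qquad D_2=W_0\cos(\omega_2\tau)-Z_0\sin(\omega_2\tau).$$ A zero $(Z_0^*,W_0^* )$ of the system $\mathcal G^1=\mathcal G^2=0$ is called simple if $\det\bigl(\partial(\mathcal G^1,\mathcal G^2)/\partial(Z_0,W_0)\bigr)\neq0$ at $(Z_0^*,W_0^* )$. A $T_2$-periodic solution "run $p$ times" is that solution regarded as a periodic solution of period $pT_2$.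 "Tending" means $\theta_k(\tau,\varepsilon)\to\theta_k(\tau)$ as $\varepsilon\to0$ for $k=1,2$ and every $\tau$. *)

theory Defs
  imports "HOL-Analysis.Analysis" "HOL-Library.Periodic_Fun"
begin

text \<open>
  On the whole space (of finite dimension), a function is of class \<open>C\<^sup>k\<^sup>+\<^sup>1\<close> iff it is differentiable
  and all its directional derivatives are of class \<open>C\<^sup>k\<close>.
\<close>
fun C_k :: "nat \<Rightarrow> ('a::euclidean_space \<Rightarrow> 'b::real_normed_vector) \<Rightarrow> bool" where
  "C_k 0 f \<longleftrightarrow> continuous_on UNIV f"
| "C_k (Suc k) f \<longleftrightarrow> (\<forall>x. f differentiable (at x)) \<and>
     (\<forall>v. C_k k (\<lambda>x. frechet_derivative f (at x) v))"

definition smooth :: "('a::euclidean_space \<Rightarrow> 'b::real_normed_vector) \<Rightarrow> bool" where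
  "smooth f \<longleftrightarrow> (\<forall>k. C_k k f)"

definition omega2 :: real where
  "omega2 = sqrt (2 + sqrt 2)"

definition T2 :: real where
  "T2 = 2 * pi / omega2"

text \<open>
  The arguments of a perturbation are \<open>(\<tau>, \<theta>\<^sub>1, \<theta>\<^sub>1', \<theta>\<^sub>2, \<theta>\<^sub>2')\<close>, identifying
  \<open>\<real> \<times> \<real>\<^sup>4\<close> with a nested product.
\<close>
type_synonym perturbation = "real \<times> real \<times> real \<times> real \<times> real \<Rightarrow> real"

definition pendulum_solution ::
  "perturbation \<Rightarrow> perturbation \<Rightarrow> real \<Rightarrow> (real \<Rightarrow> real) \<Rightarrow> (real \<Rightarrow> real) \<Rightarrow> bool" where
  "pendulum_solution F1 F2 \<epsilon> \<theta>1 \<theta>2 \<longleftrightarrow>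
     (\<forall>\<tau>. \<theta>1 differentiable (at \<tau>) \<and> \<theta>2 differentiable (at \<tau>) \<and>
       (deriv \<theta>1 has_real_derivative
          - 2 * \<theta>1 \<tau> + \<theta>2 \<tau> + \<epsilon> * F1 (\<tau>, \<theta>1 \<tau>, deriv \<theta>1 \<tau>, \<theta>2 \<tau>, deriv \<theta>2 \<tau>)) (at \<tau>) \<and>
       (deriv \<theta>2 has_real_derivative
          2 * \<theta>1 \<tau> - 2 * \<theta>2 \<tau> + \<epsilon> * F2 (\<tau>, \<theta>1 \<tau>, deriv \<theta>1 \<tau>, \<theta>2 \<tau>, deriv \<theta>2 \<tau>)) (at \<tau>))"

text \<open>
  \<open>(A2, C2)\<close> is the unperturbed solution in the eigenspace of frequency \<open>omega2\<close> with parameters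
  \<open>(Z, W)\<close>; \<open>B2\<close> and \<open>D2\<close> are the derivatives of \<open>A2\<close> and \<open>C2\<close>.
\<close>
definition A2 :: "real \<Rightarrow> real \<Rightarrow> real \<Rightarrow> real" where
  "A2 Z W \<tau> = - (1 / sqrt (4 + 2 * sqrt 2)) * (Z * cos (omega2 * \<tau>) + W * sin (omega2 * \<tau>))"

definition B2 :: "real \<Rightarrow> real \<Rightarrow> real \<Rightarrow> real" where
  "B2 Z W \<tau> = (1 / sqrt 2) * (- W * cos (omega2 * \<tau>) + Z * sin (omega2 * \<tau>))"

definition C2 :: "real \<Rightarrow> real \<Rightarrow> real \<Rightarrow> real" where
  "C2 Z W \<tau> = (1 / sqrt (2 + sqrt 2)) * (Z * cos (omega2 * \<tau>) + W * sin (omega2 * \<tau>))"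

definition D2 :: "real \<Rightarrow> real \<Rightarrow> real \<Rightarrow> real" where
  "D2 Z W \<tau> = W * cos (omega2 * \<tau>) - Z * sin (omega2 * \<tau>)"

definition along_mode2 :: "perturbation \<Rightarrow> real \<Rightarrow> real \<Rightarrow> real \<Rightarrow> real" where
  "along_mode2 F Z W \<tau> = F (\<tau>, A2 Z W \<tau>, B2 Z W \<tau>, C2 Z W \<tau>, D2 Z W \<tau>)"

definition G1 :: "perturbation \<Rightarrow> perturbation \<Rightarrow> nat \<Rightarrow> real \<Rightarrow> real \<Rightarrow> real" where
  "G1 F1 F2 p Z W = integral {0..real p * T2}
     (\<lambda>\<tau>. sin (omega2 * \<tau>) * (- sqrt 2 * along_mode2 F1 Z W \<tau> + along_mode2 F2 Z W \<tau>))"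

definition G2 :: "perturbation \<Rightarrow> perturbation \<Rightarrow> nat \<Rightarrow> real \<Rightarrow> real \<Rightarrow> real" where
  "G2 F1 F2 p Z W = integral {0..real p * T2}
     (\<lambda>\<tau>. cos (omega2 * \<tau>) * (- sqrt 2 * along_mode2 F1 Z W \<tau> + along_mode2 F2 Z W \<tau>))"

definition partials_matrix ::
  "(real \<Rightarrow> real \<Rightarrow> real) \<Rightarrow> (real \<Rightarrow> real \<Rightarrow> real) \<Rightarrow> real \<Rightarrow> real \<Rightarrow> real ^ 2 ^ 2" where
  "partials_matrix g h Z W =
     vector [vector [deriv (\<lambda>z. g z W) Z, deriv (\<lambda>w. g Z w) W],
             vector [deriv (\<lambda>z. h z W) Z, deriv (\<lambda>w. h Z w) W]]"

definition simple_zero ::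
  "(real \<Rightarrow> real \<Rightarrow> real) \<Rightarrow> (real \<Rightarrow> real \<Rightarrow> real) \<Rightarrow> real \<Rightarrow> real \<Rightarrow> bool" where
  "simple_zero g h Z W \<longleftrightarrow> g Z W = 0 \<and> h Z W = 0 \<and> det (partials_matrix g h Z W) \<noteq> 0"

end

theory Submission
  imports Defs
begin

text \<open>
  In complex modal coordinates rotating with the unperturbed flow, the pendulum becomes
  \<open>y' = \<epsilon> h(t, y)\<close>, and a solution of the pendulum has period \<open>T = p T2\<close> iff
  \<open>y(T) = (e\<^sup>i\<^sup>\<omega>\<^sup>T y\<^sub>1(0), y\<^sub>2(0))\<close> with \<open>\<omega> = omega1\<close>. The first mode is not resonant because
  \<open>omega1 / omega2 = sqrt 2 - 1\<close> is irrational, so its equation can be solved for \<open>y\<^sub>1(0) = O(\<epsilon>)\<close>.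
  The second mode gives the bifurcation equation \<open>\<integral> h\<^sub>2(t, y(t)) dt = 0\<close>, which tends to
  \<open>\<G>\<^sup>1 = \<G>\<^sup>2 = 0\<close> as \<open>\<epsilon> \<rightarrow> 0\<close>. Near a simple zero, Brouwer's theorem applied to a Newton map
  solves both equations for the initial value.
\<close>

subsection \<open>Averaging in the presence of a nonresonant component\<close>

text \<open>Brouwer's theorem only asks that the displacement over one period be continuous in the
  initial value and that the averaged map be differentiable at the zero; the flow is never
  differentiated with respect to its initial value. The price is that the solution found need not be
  unique or depend continuously on \<epsilon>. A branch is therefore handled as a statement about
  every radius \<open>r\<close>: for all small \<epsilon> some periodic solution lies within
  \<open>r\<close> of the target. Rotating coordinates matter because the time span stays fixed
  while the field carries the factor \<epsilon>. Orbits drift by O(\<epsilon>), so the integral of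
  the field along an orbit may be compared with its integral at a fixed point \<open>(0, b)\<close>.
  In the first mode a drift of O(\<epsilon>) is balanced by dividing by
  \<open>cis (omega1 * T) - 1\<close>, a nonzero constant. In the second mode \<open>G2\<close> and
  \<open>G1\<close> are the real and imaginary parts of one integral of
  \<open>cis (omega2 * t)\<close> against a real force, so that one complex equation expresses both
  conditions.\<close>

lemma lipschitz_ivp:
  fixes h :: "real \<Rightarrow> 'a::euclidean_space \<Rightarrow> 'a"
  assumes cont: "continuous_on ({0..T} \<times> UNIV) (\<lambda>(t, y). h t y)"
    and lip: "\<And>t y z. t \<in> {0..T} \<Longrightarrow> norm (h t y - h t z) \<le> K * norm (y - z)"
    and T: "0 \<le> T" and K: "0 \<le> K" "K * T \<le> 1 / 2"
  obtains Y where "\<And>x. continuous_on {0..T} (Y x)"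
    and "\<And>x t. t \<in> {0..T} \<Longrightarrow> Y x t = x + integral {0..t} (\<lambda>s. h s (Y x s))"
    and "\<And>x z t. t \<in> {0..T} \<Longrightarrow> norm (Y x t - Y z t) \<le> 2 * norm (x - z)"
proof -
  have ch: "continuous_on {0..T} (\<lambda>s. h s (apply_bcontfun y s))" for y :: "real \<Rightarrow>\<^sub>C 'a"
    by (rule continuous_on_compose2[OF cont, where f = "\<lambda>s. (s, apply_bcontfun y s)", unfolded split])
      (auto intro!: continuous_intros)
  \<comment> \<open>The Picard operator. Freezing its values outside \<open>{0..T}\<close> by
    \<open>clamp\<close> places them among the bounded continuous functions on the line, a complete
    space in the sup norm.\<close>
  have "\<exists>g. \<forall>t. apply_bcontfun g t =
      x + integral {0..clamp 0 T t} (\<lambda>s. h s (apply_bcontfun y s))" for x and y :: "real \<Rightarrow>\<^sub>C 'a"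
  proof -
    have "continuous_on (cbox 0 T) (\<lambda>t. x + integral {0..t} (\<lambda>s. h s (apply_bcontfun y s)))"
      unfolding box_real
      by (intro continuous_intros indefinite_integral_continuous_1 integrable_continuous_real ch)
    from continuous_on_cbox_bcontfunE[OF this] show ?thesis
      by metis
  qed
  then obtain \<Phi> where \<Phi>: "\<And>x y t. apply_bcontfun (\<Phi> x y) t =
      x + integral {0..clamp 0 T t} (\<lambda>s. h s (apply_bcontfun y s))"
    by metis
  \<comment> \<open>One estimate with two uses: \<open>x = z\<close> gives a contraction with factor
    1/2, and at two fixed points the last term is absorbed on the left, which yields the Lipschitz
    constant 2.\<close>
  have \<Phi>_dist: "dist (\<Phi> x y) (\<Phi> z w) \<le> norm (x - z) + 1 / 2 * dist y w" for x z y w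
  proof (rule dist_bound)
    fix t
    define c where "c = clamp 0 T t"
    have c: "c \<in> {0..T}"
      using clamp_in_interval[of 0 T t] T by (auto simp: c_def)
    have int: "(\<lambda>s. h s (apply_bcontfun v s)) integrable_on {0..c}" for v :: "real \<Rightarrow>\<^sub>C 'a"
      using c by (intro integrable_continuous_real continuous_on_subset[OF ch]) auto
    have "norm (integral {0..c} (\<lambda>s. h s (apply_bcontfun y s) - h s (apply_bcontfun w s)))
        \<le> K * dist y w * (c - 0)"
    proof (rule integral_bound)
      fix s assume "s \<in> {0..c}"
      then have "norm (h s (apply_bcontfun y s) - h s (apply_bcontfun w s))
          \<le> K * norm (apply_bcontfun y s - apply_bcontfun w s)"
        using c by (intro lip) auto
      also have "\<dots> \<le> K * dist y w"
        using dist_bounded[of y s w] K by (intro mult_left_mono) (auto simp: dist_norm)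
      finally show "norm (h s (apply_bcontfun y s) - h s (apply_bcontfun w s)) \<le> K * dist y w" .
    qed (use c in \<open>auto intro!: continuous_intros continuous_on_subset[OF ch]\<close>)
    also have "\<dots> \<le> K * T * dist y w"
      using c K T by (auto intro!: mult_mono simp: mult_ac)
    also have "\<dots> \<le> 1 / 2 * dist y w"
      using K by (intro mult_right_mono) auto
    finally have le: "norm (integral {0..c} (\<lambda>s. h s (apply_bcontfun y s))
        - integral {0..c} (\<lambda>s. h s (apply_bcontfun w s))) \<le> 1 / 2 * dist y w"
      by (simp add: integral_diff[OF int int])
    have "norm ((x - z) + (integral {0..c} (\<lambda>s. h s (apply_bcontfun y s))
        - integral {0..c} (\<lambda>s. h s (apply_bcontfun w s)))) \<le> norm (x - z) + 1 / 2 * dist y w"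
      by (rule order_trans[OF norm_triangle_ineq add_left_mono[OF le]])
    then show "dist (apply_bcontfun (\<Phi> x y) t) (apply_bcontfun (\<Phi> z w) t)
        \<le> norm (x - z) + 1 / 2 * dist y w"
      by (simp add: \<Phi> c_def[symmetric] dist_norm[where 'a = 'a] algebra_simps)
  qed
  have "\<exists>y. \<Phi> x y = y" for x
    using banach_fix_type[of "1 / 2" "\<Phi> x"] \<Phi>_dist[of x _ x] by auto
  then obtain Y where Y: "\<And>x. \<Phi> x (Y x) = Y x"
    by metis
  show thesis
  proof (rule that[of "\<lambda>x. apply_bcontfun (Y x)"])
    show "apply_bcontfun (Y x) t = x + integral {0..t} (\<lambda>s. h s (apply_bcontfun (Y x) s))"
      if "t \<in> {0..T}" for x t
      using \<Phi>[of x "Y x" t] Y[of x] that by (simp add: clamp_cancel_cbox)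
    show "norm (apply_bcontfun (Y x) t - apply_bcontfun (Y z) t) \<le> 2 * norm (x - z)" for x z t
      using \<Phi>_dist[of x "Y x" z "Y z"] dist_bounded[of "Y x" t "Y z"]
      by (simp add: Y dist_norm)
  qed auto
qed

lemma eventually_at_0_abs_mult_le:
  fixes c d :: real
  assumes "d > 0"
  shows "\<forall>\<^sub>F \<epsilon> in at 0. \<bar>\<epsilon>\<bar> * c \<le> d"
proof -
  have "((\<lambda>\<epsilon>. \<bar>\<epsilon>\<bar> * c) \<longlongrightarrow> \<bar>0\<bar> * c) (at 0)"
    by (intro tendsto_intros)
  from order_tendstoD(2)[OF this, of d] assms show ?thesis
    by (auto elim: eventually_mono)
qed

text \<open>Let \<open>I x\<close> be the integral of the field along the orbit from
  \<open>x\<close>, so that the orbit ends at \<open>x + \<epsilon> *\<^sub>R I x\<close>. As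
  \<open>S\<close> is a right inverse of \<open>R - 1\<close>, the first boundary condition is met
  by \<open>fst x = S (\<epsilon> *\<^sub>R fst (I x))\<close>; the second reads
  \<open>snd (I x) = 0\<close>. When \<open>fst x\<close> is O(\<epsilon>), \<open>snd (I x)\<close>
  is within O(\<epsilon>) of the average at \<open>(0, snd x)\<close>, whose derivative
  \<open>L\<close> is invertible.\<close>

theorem averaging:
  fixes h :: "real \<Rightarrow> 'a::euclidean_space \<times> 'b::euclidean_space \<Rightarrow> 'a \<times> 'b"
  assumes T: "0 \<le> T"
    and cont: "continuous_on ({0..T} \<times> UNIV) (\<lambda>(t, y). h t y)"
    and lip: "\<And>t y z. \<lbrakk>t \<in> {0..T}; y \<in> cball (0, b) 1; z \<in> cball (0, b) 1\<rbrakk>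
      \<Longrightarrow> norm (h t y - h t z) \<le> K * norm (y - z)"
    and S: "bounded_linear S" "\<And>a. R (S a) - S a = a"
    and zero: "integral {0..T} (\<lambda>t. snd (h t (0, b))) = 0"
    and L: "((\<lambda>b. integral {0..T} (\<lambda>t. snd (h t (0, b)))) has_derivative L) (at b)" "inj L"
    and r: "0 < r"
  shows "\<forall>\<^sub>F \<epsilon> in at 0. \<exists>y.
    (\<forall>t\<in>{0..T}. (y has_vector_derivative \<epsilon> *\<^sub>R h t (y t)) (at t within {0..T})) \<and>
    y T = (R (fst (y 0)), snd (y 0)) \<and> (\<forall>t\<in>{0..T}. norm (y t - (0, b)) \<le> r)"
proof -
  define g where "g b = integral {0..T} (\<lambda>t. snd (h t (0, b)))" for b
  \<comment> \<open>Precomposing with the projection onto a ball makes the field bounded and globally Lipschitz,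
    without changing it where the solutions found below live.\<close>
  define B where "B = cball (0 :: 'a, b) 1"
  define P where "P = closest_point B"
  have B: "convex B" "closed B" "B \<noteq> {}" "compact B" by (auto simp: B_def)
  have P_in: "P y \<in> B" for y
    unfolding P_def by (rule closest_point_in_set) (use B in auto)
  have P_id: "P y = y" if "y \<in> B" for y
    using that by (simp add: P_def closest_point_self)
  have P_cont: "continuous_on A P" for A
    unfolding P_def by (rule continuous_on_closest_point) (use B in auto)
  have P_lip: "norm (P y - P z) \<le> norm (y - z)" for y z
    using closest_point_lipschitz[OF B(1-3), of y z] by (simp add: P_def dist_norm)
  define k where "k t y = h t (P y)" for t y
  have k_cont: "continuous_on ({0..T} \<times> UNIV) (\<lambda>(t, y). k t y)"
    unfolding k_def split_beta
    by (rule continuous_on_compose2[OF cont, where f = "\<lambda>x. (fst x, P (snd x))", unfolded split_beta fst_conv snd_conv])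
      (auto intro!: continuous_intros continuous_on_compose2[OF P_cont])
  define K' where "K' = max K 0"
  have K': "0 \<le> K'" by (simp add: K'_def)
  have k_lip: "norm (k t y - k t z) \<le> K' * norm (y - z)" if "t \<in> {0..T}" for t y z
  proof -
    have "norm (k t y - k t z) \<le> K * norm (P y - P z)"
      using lip[of t "P y" "P z"] P_in that by (simp add: k_def B_def)
    also have "\<dots> \<le> K' * norm (P y - P z)"
      by (intro mult_right_mono) (auto simp: K'_def)
    also have "\<dots> \<le> K' * norm (y - z)"
      by (intro mult_left_mono P_lip K')
    finally show ?thesis .
  qed
  have "compact ((\<lambda>(t, y). h t y) ` ({0..T} \<times> B))"
    by (intro compact_continuous_image compact_Times continuous_on_subset[OF cont] B) auto
  then obtain M where M: "M > 0" and "\<forall>v\<in>(\<lambda>(t, y). h t y) ` ({0..T} \<times> B). norm v \<le> M"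
    using compact_imp_bounded bounded_pos by metis
  then have k_bound: "norm (k t y) \<le> M" if "t \<in> {0..T}" for t y
    using P_in[of y] that by (auto simp: k_def)
  obtain \<sigma> where \<sigma>: "\<sigma> > 0" "\<And>a. norm (S a) \<le> norm a * \<sigma>"
    using bounded_linear.pos_bounded[OF S(1)] by blast
  have "bounded_linear L" using L(1) by (rule has_derivative_bounded_linear)
  then have "linear L" by (rule bounded_linear.linear)
  then obtain L' where L': "linear L'" "\<And>x. L' (L x) = x" "\<And>x. L (L' x) = x"
    using linear_injective_isomorphism[OF _ L(2)] by metis
  interpret L: linear L by fact
  interpret L': linear L' by (rule L'(1))
  obtain \<Lambda> where \<Lambda>: "\<Lambda> > 0" "\<And>x. norm (L' x) \<le> norm x * \<Lambda>"
    using bounded_linear.pos_bounded[OF linear_conv_bounded_linear[THEN iffD1, OF L'(1)]] by blast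
  have "\<forall>e>0. \<exists>d>0. \<forall>x. norm (x - b) < d \<longrightarrow>
      norm (g x - g b - L (x - b)) \<le> e * norm (x - b)"
    using L(1) unfolding g_def[symmetric] has_derivative_at_alt by auto
  moreover have "1 / (2 * \<Lambda>) > 0" using \<Lambda> by simp
  ultimately obtain d where d: "d > 0" "\<And>x. norm (x - b) < d \<Longrightarrow>
      norm (g x - g b - L (x - b)) \<le> 1 / (2 * \<Lambda>) * norm (x - b)"
    by blast
  have g_b: "g b = 0" using zero by (simp add: g_def)
  \<comment> \<open>The cap at 1 keeps the orbits in \<open>B\<close>, where \<open>P\<close> is the
    identity. Since \<open>\<rho> < d\<close>, the linearization error of \<open>g\<close> is at
    most \<open>\<rho> / (2 * \<Lambda>)\<close>, which \<open>L'\<close> enlarges to at most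
    \<open>\<rho> / 2\<close>.\<close>
  define r' where "r' = min r 1"
  define \<rho> where "\<rho> = min (r' / 2) (d / 2)"
  have r': "0 < r'" "r' \<le> r" "r' \<le> 1" using r by (auto simp: r'_def)
  have \<rho>: "0 < \<rho>" "\<rho> \<le> r' / 2" "\<rho> < d" using r' d by (auto simp: \<rho>_def)
  define A where "A = \<sigma> * (M * T)"
  have A: "0 \<le> A" using \<sigma> M T by (simp add: A_def)
  \<comment> \<open>The bounds ensure, in this order: the Picard operator contracts, orbits drift by
    at most \<open>r' / 4\<close>, the first component stays below \<open>r' / 4\<close>, and the
    averaging error costs the Newton map at most the other half of \<open>\<rho>\<close>.\<close>
  have "\<forall>\<^sub>F \<epsilon> in at 0. \<epsilon> \<noteq> 0 \<and> \<bar>\<epsilon>\<bar> * (K' * T) \<le> 1 / 2 \<and> \<bar>\<epsilon>\<bar> * (M * T) \<le> r' / 4 \<and>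
      \<bar>\<epsilon>\<bar> * A \<le> r' / 4 \<and> \<bar>\<epsilon>\<bar> * (\<Lambda> * (K' * (M * T + A) * T)) \<le> \<rho> / 2"
    using r' \<rho> by (intro eventually_conj eventually_at_0_abs_mult_le) (auto intro: eventually_neq_at_within)
  then show ?thesis
  proof (rule eventually_mono, elim conjE)
    fix \<epsilon> :: real
    assume \<epsilon>: "\<epsilon> \<noteq> 0" "\<bar>\<epsilon>\<bar> * (K' * T) \<le> 1 / 2" "\<bar>\<epsilon>\<bar> * (M * T) \<le> r' / 4" "\<bar>\<epsilon>\<bar> * A \<le> r' / 4"
      "\<bar>\<epsilon>\<bar> * (\<Lambda> * (K' * (M * T + A) * T)) \<le> \<rho> / 2"
    obtain Y where Y_cont: "\<And>x. continuous_on {0..T} (Y x)"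
      and Y: "\<And>x t. t \<in> {0..T} \<Longrightarrow> Y x t = x + integral {0..t} (\<lambda>s. \<epsilon> *\<^sub>R k s (Y x s))"
      and Y_lip: "\<And>x z t. t \<in> {0..T} \<Longrightarrow> norm (Y x t - Y z t) \<le> 2 * norm (x - z)"
    proof (rule lipschitz_ivp[where h = "\<lambda>t y. \<epsilon> *\<^sub>R k t y" and T = T and K = "\<bar>\<epsilon>\<bar> * K'"])
      show "continuous_on ({0..T} \<times> UNIV) (\<lambda>(t, y). \<epsilon> *\<^sub>R k t y)"
        using k_cont unfolding split_beta by (intro continuous_intros)
      show "norm (\<epsilon> *\<^sub>R k t y - \<epsilon> *\<^sub>R k t z) \<le> \<bar>\<epsilon>\<bar> * K' * norm (y - z)" if "t \<in> {0..T}" for t y z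
        using mult_left_mono[OF k_lip[OF that, of y z] abs_ge_zero[of \<epsilon>]]
        by (simp add: scaleR_diff_right[symmetric] mult.assoc del: scaleR_diff_right)
    qed (use T K' \<epsilon> in auto)
    have k_Y: "continuous_on {0..T} (\<lambda>s. k s (Y x s))" for x
      by (rule continuous_on_compose2[OF k_cont, where f = "\<lambda>s. (s, Y x s)", unfolded split])
        (auto intro!: continuous_intros Y_cont)
    have Y_near: "norm (Y x t - x) \<le> \<bar>\<epsilon>\<bar> * (M * T)" if t: "t \<in> {0..T}" for x t
    proof -
      have "norm (integral {0..t} (\<lambda>s. \<epsilon> *\<^sub>R k s (Y x s))) \<le> \<bar>\<epsilon>\<bar> * M * (t - 0)"
      proof (rule integral_bound)
        show "continuous_on {0..t} (\<lambda>s. \<epsilon> *\<^sub>R k s (Y x s))"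
          using t by (intro continuous_intros continuous_on_subset[OF k_Y]) auto
        show "norm (\<epsilon> *\<^sub>R k s (Y x s)) \<le> \<bar>\<epsilon>\<bar> * M" if "s \<in> {0..t}" for s
          using k_bound[of s "Y x s"] t that by (simp add: mult_left_mono)
      qed (use t in auto)
      also have "\<dots> \<le> \<bar>\<epsilon>\<bar> * (M * T)"
        using t M by (auto intro!: mult_left_mono simp: mult.assoc)
      finally show ?thesis by (simp add: Y[OF t])
    qed
    define I where "I x = integral {0..T} (\<lambda>s. k s (Y x s))" for x
    have Y_T: "Y x T = x + \<epsilon> *\<^sub>R I x" for x
      using Y[of T x] T by (simp add: I_def)
    have I_bound: "norm (I x) \<le> M * T" for x
      using integral_bound[OF T k_Y, of x M] k_bound by (simp add: I_def)
    \<comment> \<open>Since \<epsilon> is nonzero, \<open>I x\<close> is a displacement divided by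
      \<epsilon>, so it inherits continuity from the endpoint of the orbit.\<close>
    have "continuous_on D (\<lambda>x. Y x T)" for D
    proof (rule lipschitz_on_continuous_on[OF lipschitz_onI])
      show "dist (Y x T) (Y z T) \<le> 2 * dist x z" for x z
        using Y_lip[of T x z] T by (simp add: dist_norm)
    qed simp
    then have "continuous_on D (\<lambda>x. (1 / \<epsilon>) *\<^sub>R (Y x T - x))" for D
      by (intro continuous_intros)
    then have I_cont: "continuous_on D I" for D
      using \<epsilon>(1) by (simp add: Y_T)
    \<comment> \<open>The fixed points of \<open>f\<close> are the initial values that satisfy the boundary condition.\<close>
    define f where "f x = (S (\<epsilon> *\<^sub>R fst (I x)), snd x - L' (snd (I x)))" for x
    \<comment> \<open>The first factor shrinks with \<epsilon>: its radius is the bound on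
      \<open>S\<close> applied to the drift, and it keeps the orbit from \<open>x\<close> within
      O(\<epsilon>) of \<open>(0, snd x)\<close>.\<close>
    define D where "D = cball (0 :: 'a) (\<bar>\<epsilon>\<bar> * A) \<times> cball b \<rho>"
    have f_cont: "continuous_on D f"
      unfolding f_def
      by (intro continuous_intros bounded_linear.continuous_on[OF S(1)] I_cont
          linear_continuous_on_compose[OF _ L'(1)])
    have f_D: "f x \<in> D" if x: "x \<in> D" for x
    proof -
      define b0 where "b0 = snd x"
      have x_eq: "x = (fst x, b0)" by (simp add: b0_def)
      have fst_x: "norm (fst x) \<le> \<bar>\<epsilon>\<bar> * A" and b0: "norm (b0 - b) \<le> \<rho>"
        using x by (auto simp: D_def b0_def mem_Times_iff dist_norm norm_minus_commute)
      have "norm (S (\<epsilon> *\<^sub>R fst (I x))) \<le> norm (\<epsilon> *\<^sub>R fst (I x)) * \<sigma>"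
        by (rule \<sigma>(2))
      also have "\<dots> \<le> \<bar>\<epsilon>\<bar> * A"
        using mult_left_mono[OF order_trans[OF norm_fst_le[of "fst (I x)" "snd (I x)", unfolded prod.collapse] I_bound], of "\<bar>\<epsilon>\<bar> * \<sigma>"] \<sigma>(1)
        by (simp add: A_def mult_ac)
      finally have 1: "norm (S (\<epsilon> *\<^sub>R fst (I x))) \<le> \<bar>\<epsilon>\<bar> * A" .
      have b0_B: "(0, b0) \<in> B"
        using b0 \<rho> r' by (auto simp: B_def dist_norm norm_Pair norm_minus_commute)
      have k_b0: "k t (0, b0) = h t (0, b0)" for t
        by (simp add: k_def P_id[OF b0_B])
      have k_b0_cont: "continuous_on {0..T} (\<lambda>s. k s (0, b0))"
        by (rule continuous_on_compose2[OF k_cont, where f = "\<lambda>s. (s, (0, b0))", unfolded split])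
          (auto intro!: continuous_intros)
      have "I x - integral {0..T} (\<lambda>s. k s (0, b0)) = integral {0..T} (\<lambda>s. k s (Y x s) - k s (0, b0))"
        unfolding I_def by (intro integral_diff[symmetric] integrable_continuous_real k_Y k_b0_cont)
      also have "norm \<dots> \<le> K' * (\<bar>\<epsilon>\<bar> * (M * T) + \<bar>\<epsilon>\<bar> * A) * (T - 0)"
      proof (rule integral_bound)
        fix s assume s: "s \<in> {0..T}"
        have "Y x s - (0, b0) = (Y x s - x) + (fst x, 0)"
          by (simp add: prod_eq_iff b0_def)
        also have "norm \<dots> \<le> norm (Y x s - x) + norm (fst x)"
          using norm_triangle_ineq[of "Y x s - x" "(fst x, 0)"] by simp
        also have "\<dots> \<le> \<bar>\<epsilon>\<bar> * (M * T) + \<bar>\<epsilon>\<bar> * A"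
          by (intro add_mono Y_near s fst_x)
        finally show "norm (k s (Y x s) - k s (0, b0)) \<le> K' * (\<bar>\<epsilon>\<bar> * (M * T) + \<bar>\<epsilon>\<bar> * A)"
          by (intro order_trans[OF k_lip[OF s]] mult_left_mono K')
      qed (use T in \<open>auto intro!: continuous_intros k_Y k_b0_cont\<close>)
      finally have I_near: "norm (I x - integral {0..T} (\<lambda>s. k s (0, b0)))
          \<le> K' * (\<bar>\<epsilon>\<bar> * (M * T) + \<bar>\<epsilon>\<bar> * A) * T"
        by simp
      have "g b0 = snd (integral {0..T} (\<lambda>s. k s (0, b0)))"
        using integral_linear[OF integrable_continuous_real[OF k_b0_cont] bounded_linear_snd]
        by (simp add: g_def k_b0 o_def)
      then have "norm (snd (I x) - g b0) \<le> norm (I x - integral {0..T} (\<lambda>s. k s (0, b0)))"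
        using norm_snd_le[of "snd p" "fst p" for p :: "'a \<times> 'b"] by (simp flip: snd_diff)
      with I_near have snd_near: "norm (snd (I x) - g b0) \<le> \<bar>\<epsilon>\<bar> * (K' * (M * T + A) * T)"
        by (simp add: algebra_simps)
      have g_near: "norm (g b0 - L (b0 - b)) \<le> 1 / (2 * \<Lambda>) * \<rho>"
        using d(2)[of b0] b0 \<rho> \<Lambda> g_b
          mult_left_mono[OF b0, of "1 / (2 * \<Lambda>)"] by simp
      \<comment> \<open>The distance of a Newton step from \<open>b\<close> splits into the
        averaging error and the linearization remainder of \<open>g\<close>; after \<open>L'\<close>
        each is at most \<open>\<rho> / 2\<close>.\<close>
      have "snd (f x) - b = - L' ((snd (I x) - g b0) + (g b0 - L (b0 - b)))"
        by (simp add: f_def b0_def[symmetric] L'.diff L'.add L'(2))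
      also have "norm \<dots> \<le> norm ((snd (I x) - g b0) + (g b0 - L (b0 - b))) * \<Lambda>"
        by (simp add: \<Lambda>(2) del: diff_add_cancel add_diff_eq)
      also have "\<dots> \<le> (\<bar>\<epsilon>\<bar> * (K' * (M * T + A) * T) + 1 / (2 * \<Lambda>) * \<rho>) * \<Lambda>"
        using \<Lambda> by (intro mult_right_mono norm_triangle_mono snd_near g_near) auto
      also have "\<dots> = \<bar>\<epsilon>\<bar> * (\<Lambda> * (K' * (M * T + A) * T)) + \<rho> / 2"
        using \<Lambda> by (simp add: field_simps)
      also have "\<dots> \<le> \<rho>" using \<epsilon>(5) by simp
      finally have "norm (snd (f x) - b) \<le> \<rho>" .
      with 1 show ?thesis
        by (simp add: D_def mem_Times_iff f_def dist_norm norm_minus_commute)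
    qed
    have "compact D" "convex D" "D \<noteq> {}"
      using \<rho> mult_nonneg_nonneg[OF abs_ge_zero A, of \<epsilon>]
      by (auto simp: D_def not_less intro: compact_Times convex_Times)
    with f_cont f_D obtain x where x: "x \<in> D" "f x = x"
      using brouwer[of D f] by blast
    have "L' (snd (I x)) = 0" and fst_x: "S (\<epsilon> *\<^sub>R fst (I x)) = fst x"
      using x(2) by (auto simp: f_def prod_eq_iff)
    then have snd_I: "snd (I x) = 0"
      using L'(3)[of "snd (I x)"] L.zero by simp
    have Y_0: "Y x 0 = x" using Y[of 0 x] T by simp
    have near: "norm (Y x t - (0, b)) \<le> r'" if t: "t \<in> {0..T}" for t
    proof -
      have "Y x t - (0, b) = (Y x t - x) + (fst x, snd x - b)"
        by (simp add: prod_eq_iff)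
      also have "norm \<dots> \<le> r' / 4 + (r' / 4 + r' / 2)"
      proof (intro norm_triangle_mono order_trans[OF norm_Pair_le] add_mono)
        show "norm (Y x t - x) \<le> r' / 4" using Y_near[OF t, of x] \<epsilon>(3) by simp
        show "norm (fst x) \<le> r' / 4" "norm (snd x - b) \<le> r' / 2"
          using x(1) \<epsilon>(4) \<rho> by (auto simp: D_def mem_Times_iff dist_norm norm_minus_commute)
      qed
      finally show ?thesis by simp
    qed
    have k_h: "k t (Y x t) = h t (Y x t)" if "t \<in> {0..T}" for t
      using near[OF that] r' by (simp add: k_def P_id B_def dist_norm norm_minus_commute)
    show "\<exists>y. (\<forall>t\<in>{0..T}. (y has_vector_derivative \<epsilon> *\<^sub>R h t (y t)) (at t within {0..T})) \<and>
        y T = (R (fst (y 0)), snd (y 0)) \<and> (\<forall>t\<in>{0..T}. norm (y t - (0, b)) \<le> r)"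
    proof (intro exI[of _ "Y x"] conjI ballI)
      fix t assume t: "t \<in> {0..T}"
      have "((\<lambda>t. x + integral {0..t} (\<lambda>s. \<epsilon> *\<^sub>R k s (Y x s))) has_vector_derivative
          0 + \<epsilon> *\<^sub>R k t (Y x t)) (at t within {0..T})"
        by (intro has_vector_derivative_add has_vector_derivative_const
            integral_has_vector_derivative continuous_intros k_Y t)
      then show "(Y x has_vector_derivative \<epsilon> *\<^sub>R h t (Y x t)) (at t within {0..T})"
        using has_vector_derivative_transform[OF t, of "Y x"] Y by (simp add: k_h[OF t])
      show "norm (Y x t - (0, b)) \<le> r" using near[OF t] r' by simp
    next
      show "Y x T = (R (fst (Y x 0)), snd (Y x 0))"
        using S(2)[of "\<epsilon> *\<^sub>R fst (I x)"] snd_I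
        by (simp add: Y_T Y_0 prod_eq_iff fst_x diff_eq_eq)
    qed
  qed
qed

subsection \<open>Periodic extension and choice of solutions\<close>

lemma has_vector_derivative_within_Un:
  assumes "(f has_vector_derivative D) (at x within A)" "(f has_vector_derivative D) (at x within B)"
  shows "(f has_vector_derivative D) (at x within A \<union> B)"
  using assms by (simp add: has_vector_derivative_def has_derivative_within Lim_within_Un)

text \<open>The delicate points are the multiples of \<open>T\<close>. There the neighbouring copies
  of \<open>u\<close> meet because \<open>u T = u 0\<close>, and their one-sided derivatives agree
  because both equal the field at the common value.\<close>

lemma periodic_extension:
  fixes u :: "real \<Rightarrow> 'a::real_normed_vector"
  assumes T: "T > 0"
    and u: "\<And>t. t \<in> {0..T} \<Longrightarrow> (u has_vector_derivative f t (u t)) (at t within {0..T})"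
    and u_T: "u T = u 0"
    and f: "\<And>x. periodic_fun_simple (\<lambda>t. f t x) T"
  obtains U where "\<And>t. (U has_vector_derivative f t (U t)) (at t)"
    and "periodic_fun_simple U T"
    and "\<And>t. t \<in> {0..T} \<Longrightarrow> U t = u t"
proof -
  define U where "U t = u (t - of_int \<lfloor>t / T\<rfloor> * T)" for t
  \<comment> \<open>The cell is closed: at its right end the floor has already jumped to
    \<open>k + 1\<close>, and \<open>u T = u 0\<close> absorbs the jump.\<close>
  have U_eq: "U t = u (t - of_int k * T)" if t: "t \<in> {of_int k * T..of_int k * T + T}" for t k
  proof (cases "t = of_int k * T + T")
    case True
    then have "\<lfloor>t / T\<rfloor> = k + 1"
      using T by (intro floor_unique) (auto simp: field_simps)
    then show ?thesis
      using True by (simp add: U_def u_T algebra_simps)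
  next
    case False
    then have "\<lfloor>t / T\<rfloor> = k"
      using t T by (intro floor_unique) (auto simp: field_simps)
    then show ?thesis
      by (simp add: U_def)
  qed
  have U_within: "(U has_vector_derivative f t (U t)) (at t within {of_int k * T..of_int k * T + T})"
    if t: "t \<in> {of_int k * T..of_int k * T + T}" for t k
  proof (rule has_vector_derivative_transform[OF t])
    let ?S = "{of_int k * T..of_int k * T + T}"
    have *: "((\<lambda>s. s - of_int k * T) has_vector_derivative 1) (at t within ?S)"
      by (auto intro!: derivative_eq_intros)
    have "(u has_vector_derivative f (t - of_int k * T) (u (t - of_int k * T)))
        (at (t - of_int k * T) within (\<lambda>s. s - of_int k * T) ` ?S)"
      using t by (intro has_vector_derivative_within_subset[OF u]) auto
    from vector_diff_chain_within[OF * this]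
    have "((\<lambda>s. u (s - of_int k * T)) has_vector_derivative
        f (t - of_int k * T) (u (t - of_int k * T))) (at t within ?S)"
      by (simp add: o_def)
    moreover have "f (t - of_int k * T) x = f t x" for x
    proof -
      interpret periodic_fun_simple "\<lambda>t. f t x" T by (rule f)
      show ?thesis by (rule minus_of_int)
    qed
    ultimately show "((\<lambda>s. u (s - of_int k * T)) has_vector_derivative f t (U t)) (at t within ?S)"
      using U_eq[OF t] by simp
  qed (use U_eq in auto)
  show thesis
  proof (rule that[of U])
    fix t
    define k where "k = \<lfloor>t / T\<rfloor>"
    have k: "of_int k * T \<le> t" "t < of_int k * T + T"
      using floor_divide_lower[OF T, of t] floor_divide_upper[OF T, of t]
      by (auto simp: k_def algebra_simps)
    show "(U has_vector_derivative f t (U t)) (at t)"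
    proof (cases "t = of_int k * T")
      case True
      have "{of_int (k - 1) * T..of_int (k - 1) * T + T} \<union> {of_int k * T..of_int k * T + T}
          = {of_int k * T - T..of_int k * T + T}"
        using T by (auto simp: algebra_simps)
      moreover have "(U has_vector_derivative f t (U t)) (at t within
          {of_int (k - 1) * T..of_int (k - 1) * T + T} \<union> {of_int k * T..of_int k * T + T})"
        using True T by (intro has_vector_derivative_within_Un U_within) (auto simp: algebra_simps)
      ultimately show ?thesis
        using True T at_within_Icc_at[of "of_int k * T - T" t "of_int k * T + T"] by simp
    next
      case False
      then show ?thesis
        using U_within[of t k] k at_within_Icc_at[of "of_int k * T" t "of_int k * T + T"] by simp
    qed
  next
    show "periodic_fun_simple U T"
    proof
      fix t
      have "\<lfloor>(t + T) / T\<rfloor> = \<lfloor>t / T\<rfloor> + 1"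
        using T by (simp add: add_divide_distrib)
      then show "U (t + T) = U t"
        by (simp add: U_def algebra_simps)
    qed
  next
    show "U t = u t" if "t \<in> {0..T}" for t
      using U_eq[of t 0] that by simp
  qed
qed

text \<open>
  The bound \<open>\<epsilon>0\<close> in the theorem must serve all zeros at once, although each zero controls its own
  branch only for small \<open>\<epsilon>\<close>. It suffices that some solution exists for every \<open>\<epsilon>\<close> below \<open>\<epsilon>0\<close>:
  picking solutions that are almost closest to the target gives convergence.
\<close>
lemma near_optimal_selection:
  fixes P :: "real \<Rightarrow> 'a \<Rightarrow> bool" and Q :: "'a \<Rightarrow> real \<Rightarrow> bool"
  assumes ex: "\<And>\<epsilon>. \<lbrakk>\<epsilon> \<noteq> 0; \<bar>\<epsilon>\<bar> < \<epsilon>0\<rbrakk> \<Longrightarrow> \<exists>s. P \<epsilon> s"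
    and near: "\<And>r. r > 0 \<Longrightarrow> \<forall>\<^sub>F \<epsilon> in at 0. \<exists>s. P \<epsilon> s \<and> Q s r"
    and mono: "\<And>s r r'. \<lbrakk>Q s r; r \<le> r'\<rbrakk> \<Longrightarrow> Q s r'"
  obtains s where "\<And>\<epsilon>. \<lbrakk>\<epsilon> \<noteq> 0; \<bar>\<epsilon>\<bar> < \<epsilon>0\<rbrakk> \<Longrightarrow> P \<epsilon> (s \<epsilon>)"
    and "\<And>r. r > 0 \<Longrightarrow> \<forall>\<^sub>F \<epsilon> in at 0. Q (s \<epsilon>) r"
proof -
  define E where "E \<epsilon> = {r. r > 0 \<and> (\<exists>s. P \<epsilon> s \<and> Q s r)}" for \<epsilon>
  have E_bdd: "bdd_below (E \<epsilon>)" for \<epsilon>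
    by (rule bdd_belowI[of _ 0]) (auto simp: E_def)
  \<comment> \<open>The infimum of the accuracies need not be attained; the slack
    \<bar>\<epsilon>\<bar> is positive for nonzero \<epsilon> and vanishes in the limit. Where
    \<open>E \<epsilon>\<close> is empty, only \<open>P\<close> is requested.\<close>
  have "\<exists>s. ((\<exists>s. P \<epsilon> s) \<longrightarrow> P \<epsilon> s) \<and> (E \<epsilon> \<noteq> {} \<and> \<epsilon> \<noteq> 0 \<longrightarrow> (\<exists>r. Q s r \<and> r < Inf (E \<epsilon>) + \<bar>\<epsilon>\<bar>))" for \<epsilon>
  proof (cases "E \<epsilon> \<noteq> {} \<and> \<epsilon> \<noteq> 0")
    case True
    then obtain r where "r \<in> E \<epsilon>" "r < Inf (E \<epsilon>) + \<bar>\<epsilon>\<bar>"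
      using cInf_lessD[of "E \<epsilon>" "Inf (E \<epsilon>) + \<bar>\<epsilon>\<bar>"] by auto
    then show ?thesis by (auto simp: E_def)
  qed auto
  then obtain s where s: "\<And>\<epsilon>. (\<exists>s. P \<epsilon> s) \<Longrightarrow> P \<epsilon> (s \<epsilon>)"
    "\<And>\<epsilon>. \<lbrakk>E \<epsilon> \<noteq> {}; \<epsilon> \<noteq> 0\<rbrakk> \<Longrightarrow> \<exists>r. Q (s \<epsilon>) r \<and> r < Inf (E \<epsilon>) + \<bar>\<epsilon>\<bar>"
    by metis
  show thesis
  proof (rule that[of s])
    fix r :: real assume r: "r > 0"
    have "\<forall>\<^sub>F \<epsilon> in at (0 :: real). \<bar>\<epsilon>\<bar> < r / 2"
      using r by (auto simp: eventually_at dist_real_def intro!: exI[of _ "r / 2"])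
    moreover have "\<forall>\<^sub>F \<epsilon> in at (0 :: real). \<epsilon> \<noteq> 0"
      by (rule eventually_neq_at_within)
    moreover have "\<forall>\<^sub>F \<epsilon> in at 0. \<exists>s. P \<epsilon> s \<and> Q s (r / 2)"
      using near r by simp
    ultimately show "\<forall>\<^sub>F \<epsilon> in at 0. Q (s \<epsilon>) r"
    proof eventually_elim
      case (elim \<epsilon>)
      then have "r / 2 \<in> E \<epsilon>"
        using r by (auto simp: E_def)
      then have "Inf (E \<epsilon>) \<le> r / 2" "E \<epsilon> \<noteq> {}"
        using cInf_lower[OF _ E_bdd, of "r / 2"] by auto
      with s(2) elim obtain r' where "Q (s \<epsilon>) r'" "r' < Inf (E \<epsilon>) + \<bar>\<epsilon>\<bar>"
        by blast
      then show ?case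
        using \<open>Inf (E \<epsilon>) \<le> r / 2\<close> elim(1) by (intro mono[of "s \<epsilon>" r' r]) auto
    qed
  qed (use s(1) ex in blast)
qed

subsection \<open>Continuously differentiable functions\<close>

text \<open>With values in \<open>blinfun\<close> the derivative is continuous in the operator norm,
  the form needed for Lipschitz constants on compact sets and for the Leibniz rule.\<close>

definition C1 :: "('a::euclidean_space \<Rightarrow> 'b::real_normed_vector) \<Rightarrow> bool" where
  "C1 f \<longleftrightarrow> (\<exists>f'. (\<forall>x. (f has_derivative blinfun_apply (f' x)) (at x)) \<and> continuous_on UNIV f')"

text \<open>In finite dimension, continuity of every directional derivative already gives continuity
  in the operator norm.\<close>

lemma smooth_imp_C1:
  assumes "smooth f"
  shows "C1 f"
proof -
  have "C_k (Suc 0) f"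
    using assms by (simp add: smooth_def)
  then have diff: "f differentiable (at x)"
    and cont: "continuous_on UNIV (\<lambda>x. frechet_derivative f (at x) v)" for x v
    by auto
  have deriv: "(f has_derivative frechet_derivative f (at x)) (at x)" for x
    using diff frechet_derivative_works by blast
  then have eq: "blinfun_apply (Blinfun (frechet_derivative f (at x))) = frechet_derivative f (at x)" for x
    by (intro bounded_linear_Blinfun_apply has_derivative_bounded_linear)
  show ?thesis
    unfolding C1_def
    by (intro exI[of _ "\<lambda>x. Blinfun (frechet_derivative f (at x))"] conjI allI
        continuous_on_blinfun_componentwise) (simp_all add: eq deriv cont)
qed

lemma C1_linear_combination:
  fixes f g :: "'a::euclidean_space \<Rightarrow> real"
  assumes "C1 f" "C1 g"
  shows "C1 (\<lambda>x. a * f x + g x)"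
proof -
  from assms obtain f' g' where
    f': "\<And>x. (f has_derivative blinfun_apply (f' x)) (at x)" "continuous_on UNIV f'" and
    g': "\<And>x. (g has_derivative blinfun_apply (g' x)) (at x)" "continuous_on UNIV g'"
    by (auto simp: C1_def)
  have "((\<lambda>x. a * f x + g x) has_derivative blinfun_apply (a *\<^sub>R f' x + g' x)) (at x)" for x
  proof (rule has_derivative_eq_rhs)
    show "((\<lambda>x. a * f x + g x) has_derivative (\<lambda>v. a * f' x v + g' x v)) (at x)"
      by (intro has_derivative_add has_derivative_mult_right f' g')
  qed (auto simp: blinfun.bilinear_simps)
  moreover have "continuous_on UNIV (\<lambda>x. a *\<^sub>R f' x + g' x)"
    by (intro continuous_intros f' g')
  ultimately show ?thesis
    unfolding C1_def by (intro exI[of _ "\<lambda>x. a *\<^sub>R f' x + g' x"]) simp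
qed

lemma C1_imp_continuous_on:
  assumes "C1 f"
  shows "continuous_on A f"
  using assms unfolding C1_def
  by (meson continuous_at_imp_continuous_on has_derivative_continuous)

lemma C1_lipschitz_compact:
  assumes f: "C1 f" and A: "compact A" "convex A"
  obtains K where "K \<ge> 0" and "\<And>x y. \<lbrakk>x \<in> A; y \<in> A\<rbrakk> \<Longrightarrow> norm (f x - f y) \<le> K * norm (x - y)"
proof -
  from f obtain f' where f': "\<And>x. (f has_derivative blinfun_apply (f' x)) (at x)" "continuous_on UNIV f'"
    by (auto simp: C1_def)
  have "compact (f' ` A)"
    by (intro compact_continuous_image continuous_on_subset[OF f'(2)] A) auto
  then obtain K where K: "K > 0" "\<And>x. x \<in> A \<Longrightarrow> norm (f' x) \<le> K"
    using compact_imp_bounded bounded_pos by (metis image_eqI)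
  show thesis
  proof (rule that[of K])
    show "norm (f x - f y) \<le> K * norm (x - y)" if "x \<in> A" "y \<in> A" for x y
      using K that by (intro differentiable_bound[OF A(2) has_derivative_at_withinI[OF f'(1)]])
        (auto simp: norm_blinfun.rep_eq)
  qed (use K in auto)
qed

text \<open>Differentiation under the integral sign; \<open>J\<close> restricts the derivative of
  \<open>f\<close> to the space variables. Mere existence of \<open>L\<close> suffices, because
  \<open>simple_zero_inj\<close> recovers its values from the partial derivatives.\<close>

lemma parametric_integral_has_derivative:
  fixes f :: "real \<times> 'c::euclidean_space \<Rightarrow> real" and e :: "real \<Rightarrow> 'b::euclidean_space \<Rightarrow>\<^sub>L 'c"
  assumes f: "C1 f" and c: "continuous_on {0..T} c" and e: "continuous_on {0..T} e"
  shows "\<exists>L. ((\<lambda>b. integral {0..T} (\<lambda>t. c t * f (t, blinfun_apply (e t) b))) has_derivative L) (at b0)"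
proof -
  from f obtain f' where f': "\<And>x. (f has_derivative blinfun_apply (f' x)) (at x)" "continuous_on UNIV f'"
    by (auto simp: C1_def)
  define J :: "'c \<Rightarrow>\<^sub>L (real \<times> 'c)" where "J = Blinfun (Pair 0)"
  have J: "blinfun_apply J x = (0, x)" for x
    unfolding J_def by (subst bounded_linear_Blinfun_apply)
      (auto intro!: bounded_linear_Pair bounded_linear_zero bounded_linear_ident)
  define F where "F b t = c t *\<^sub>R (f' (t, blinfun_apply (e t) b) o\<^sub>L J o\<^sub>L e t)" for b t
  have "((\<lambda>b. integral (cbox 0 T) (\<lambda>t. c t * f (t, blinfun_apply (e t) b))) has_derivative
      blinfun_apply (integral (cbox 0 T) (F b0))) (at b0 within UNIV)"
  proof (rule leibniz_rule)
    fix b t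
    have "((\<lambda>b. (t, blinfun_apply (e t) b)) has_derivative (\<lambda>v. (0, blinfun_apply (e t) v))) (at b)"
      by (auto intro!: derivative_eq_intros)
    note has_derivative_mult_right[OF has_derivative_compose[OF this f'(1)], of "c t"]
    moreover have "blinfun_apply (F b t) = (\<lambda>v. c t * f' (t, e t b) (0, e t v))"
      by (auto simp: F_def J blinfun.bilinear_simps)
    ultimately show "((\<lambda>b. c t * f (t, blinfun_apply (e t) b)) has_derivative blinfun_apply (F b t)) (at b within UNIV)"
      by simp
  next
    fix b
    have "continuous_on {0..T} (\<lambda>t. f (t, e t b))"
      by (rule continuous_on_compose2[OF C1_imp_continuous_on[OF f, of UNIV]])
        (auto intro!: continuous_intros e)
    then show "(\<lambda>t. c t * f (t, e t b)) integrable_on cbox 0 T"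
      unfolding box_real by (intro integrable_continuous_real continuous_intros c)
  next
    let ?D = "UNIV \<times> {0..T} :: ('b \<times> real) set"
    have c': "continuous_on ?D (\<lambda>x. c (snd x))"
      by (rule continuous_on_compose2[OF c continuous_on_snd[OF continuous_on_id]]) auto
    have e': "continuous_on ?D (\<lambda>x. e (snd x))"
      by (rule continuous_on_compose2[OF e continuous_on_snd[OF continuous_on_id]]) auto
    have f'': "continuous_on ?D (\<lambda>x. f' (snd x, e (snd x) (fst x)))"
      by (rule continuous_on_compose2[OF f'(2)]) (auto intro!: continuous_intros e')
    show "continuous_on (UNIV \<times> cbox 0 T) (\<lambda>(b, t). F b t)"
      unfolding F_def split_beta box_real
      by (intro continuous_on_scaleR bounded_bilinear.continuous_on[OF bounded_bilinear_blinfun_compose]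
          continuous_on_const c' e' f'')
  qed auto
  then show ?thesis by auto
qed

subsection \<open>Normal modes of the double pendulum\<close>

definition omega1 :: real where
  "omega1 = sqrt (2 - sqrt 2)"

lemma sqrt_2_less_2: "sqrt 2 < 2"
  by (simp add: real_sqrt_less_iff[of 2 4, simplified])

lemma omega_pos [simp]: "omega1 > 0" "omega2 > 0"
  using sqrt_2_less_2 by (auto simp: omega1_def omega2_def intro: add_pos_pos)

lemma omega_nonzero [simp]: "omega1 \<noteq> 0" "omega2 \<noteq> 0"
  using omega_pos by linarith+

lemma omega1_square: "omega1 * omega1 = 2 - sqrt 2"
  using sqrt_2_less_2 by (simp add: omega1_def)

lemma omega2_square: "omega2 * omega2 = 2 + sqrt 2"
  by (simp add: omega2_def add_nonneg_nonneg)

lemma omega1_eq: "omega1 = (sqrt 2 - 1) * omega2"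
proof (rule power2_eq_imp_eq)
  have "((sqrt 2 - 1) * omega2)\<^sup>2 = (sqrt 2 - 1)\<^sup>2 * (2 + sqrt 2)"
    using omega2_square by (simp add: power2_eq_square mult_ac)
  also have "\<dots> = 2 - sqrt 2"
    by (simp add: power2_eq_square algebra_simps)
  finally show "omega1\<^sup>2 = ((sqrt 2 - 1) * omega2)\<^sup>2"
    using omega1_square by (simp add: power2_eq_square)
qed (auto simp: less_imp_le)

lemma T2_pos [simp]: "T2 > 0"
  by (simp add: T2_def)

lemma omega2_T2: "omega2 * T2 = 2 * pi"
  by (simp add: T2_def)

lemma cis_omega2_period: "cis (omega2 * (real p * T2)) = 1"
proof -
  have "omega2 * (real p * T2) = real p * (omega2 * T2)"
    by simp
  then have "cis (omega2 * (real p * T2)) = cis (2 * pi) ^ p"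
    by (simp only: Complex.DeMoivre omega2_T2)
  then show ?thesis
    by simp
qed

lemma sqrt_2_irrational: "sqrt 2 \<notin> \<rat>"
proof
  assume "sqrt 2 \<in> \<rat>"
  then obtain m n :: nat where n: "n \<noteq> 0" and eq: "\<bar>sqrt 2\<bar> = real m / real n" and "coprime m n"
    by (rule Rats_abs_nat_div_natE)
  then have "(real m)\<^sup>2 = (sqrt 2 * real n)\<^sup>2"
    by (simp add: field_simps)
  then have "real (m\<^sup>2) = real (2 * n\<^sup>2)"
    by (simp add: power_mult_distrib)
  then have sq: "m\<^sup>2 = 2 * n\<^sup>2"
    by (simp only: of_nat_eq_iff)
  then have "even (m\<^sup>2)" by simp
  then have "even m" by simp
  then obtain k where "m = 2 * k" by (rule evenE)
  with sq have "n\<^sup>2 = 2 * k\<^sup>2" by (simp add: power_mult_distrib)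
  then have "even (n\<^sup>2)" by simp
  then have "even n" by simp
  with \<open>even m\<close> \<open>coprime m n\<close> show False
    by (meson coprime_common_divisor_nat numeral_One odd_one coprime_common_divisor)
qed

text \<open>A return of the first mode after time \<open>real p * T2\<close> would make
  \<open>(sqrt 2 - 1) * real p\<close> an integer and hence \<open>sqrt 2\<close> rational.\<close>

lemma cis_omega1_period:
  assumes "p > 0"
  shows "cis (omega1 * (real p * T2)) \<noteq> 1"
proof
  assume "cis (omega1 * (real p * T2)) = 1"
  then have "cos (omega1 * (real p * T2)) = 1"
    by (metis cis.sel(1) one_complex.sel(1))
  then obtain n :: int where "omega1 * (real p * T2) = of_int n * 2 * pi"
    using cos_one_2pi_int by blast
  moreover have "omega1 * (real p * T2) = (sqrt 2 - 1) * real p * (omega2 * T2)"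
    by (simp add: omega1_eq)
  ultimately have "(sqrt 2 - 1) * real p = of_int n"
    by (simp add: omega2_T2)
  then have "sqrt 2 = of_int n / of_nat p + 1"
    using assms by (simp add: field_simps)
  also have "\<dots> \<in> \<rat>"
    by (intro Rats_add Rats_divide Rats_of_int Rats_of_nat Rats_1)
  finally show False
    using sqrt_2_irrational by simp
qed

text \<open>
  \<open>x = (\<xi>, \<eta>)\<close> packs the two normal modes with their velocities: on the unperturbed flow
  \<open>\<xi>' = - \<i> omega1 \<xi>\<close> and \<open>\<eta>' = - \<i> omega2 \<eta>\<close>, which \<open>rotate_modes\<close> integrates. The scaling
  is chosen so that \<open>\<eta> = Z + \<i> W\<close> at time 0 reproduces \<open>A2\<close>, \<open>B2\<close>, \<open>C2\<close>, \<open>D2\<close>.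
\<close>
definition modes_state :: "complex \<times> complex \<Rightarrow> real \<times> real \<times> real \<times> real" where
  "modes_state x = ((Re (fst x) / omega1 - Re (snd x) / omega2) / sqrt 2, (Im (fst x) - Im (snd x)) / sqrt 2,
     Re (fst x) / omega1 + Re (snd x) / omega2, Im (fst x) + Im (snd x))"

definition rotate_modes :: "real \<Rightarrow> complex \<times> complex \<Rightarrow> complex \<times> complex" where
  "rotate_modes t x = (fst x * cis (- (omega1 * t)), snd x * cis (- (omega2 * t)))"

lemma bounded_linear_modes_state: "bounded_linear modes_state"
  unfolding linear_conv_bounded_linear[symmetric]
  by (rule linearI) (simp_all add: modes_state_def add_divide_distrib diff_divide_distrib algebra_simps)

lemma bounded_linear_rotate_modes: "bounded_linear (rotate_modes t)"
  unfolding linear_conv_bounded_linear[symmetric]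
  by (rule linearI) (simp_all add: rotate_modes_def algebra_simps)

lemma norm_rotate_modes [simp]: "norm (rotate_modes t x) = norm x"
  by (cases x) (simp add: rotate_modes_def norm_Pair norm_mult)

lemma continuous_on_rotate_modes [continuous_intros]:
  assumes "continuous_on A f" "continuous_on A g"
  shows "continuous_on A (\<lambda>x. rotate_modes (f x) (g x))"
  unfolding rotate_modes_def by (intro continuous_intros assms)

lemma modes_state_rotate_resonant:
  "modes_state (rotate_modes t (0, b)) =
     (A2 (Re b) (Im b) t, B2 (Re b) (Im b) t, C2 (Re b) (Im b) t, D2 (Re b) (Im b) t)"
proof -
  have "sqrt (4 + 2 * sqrt 2) = sqrt 2 * omega2"
    by (simp add: omega2_def flip: real_sqrt_mult)
  then show ?thesis
    by (simp add: modes_state_def rotate_modes_def A2_def B2_def C2_def D2_def omega2_def[symmetric]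
        diff_divide_distrib add_divide_distrib mult_ac)
qed

context
  fixes F1 F2 :: perturbation
begin

text \<open>The row vectors \<open>(sqrt 2, 1)\<close> and \<open>(- sqrt 2, 1)\<close> are left
  eigenvectors of the unperturbed system, for the eigenvalues minus \<open>omega1\<close> squared
  and minus \<open>omega2\<close> squared. Applied to the angles they give twice the amplitudes
  \<open>Re (fst x) / omega1\<close> and \<open>Re (snd x) / omega2\<close>, hence the factor
  \<open>\<epsilon> / 2\<close> in \<open>mode_field\<close>.\<close>

definition mode_force1 :: perturbation where
  "mode_force1 x = sqrt 2 * F1 x + F2 x"

definition mode_force2 :: perturbation where
  "mode_force2 x = - sqrt 2 * F1 x + F2 x"

definition mode_field :: "real \<Rightarrow> real \<Rightarrow> complex \<times> complex \<Rightarrow> complex \<times> complex" where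
  "mode_field \<epsilon> t x = (\<i> * of_real (- omega1) * fst x + \<i> * of_real (\<epsilon> / 2 * mode_force1 (t, modes_state x)),
     \<i> * of_real (- omega2) * snd x + \<i> * of_real (\<epsilon> / 2 * mode_force2 (t, modes_state x)))"

text \<open>The real parts of the field carry no force, which makes the second and fourth components
  of \<open>modes_state\<close> the derivatives of the first and third. The imaginary parts then
  supply the second-order equations.\<close>

lemma mode_solution:
  assumes x: "\<And>t. (x has_vector_derivative mode_field \<epsilon> t (x t)) (at t)"
  shows "pendulum_solution F1 F2 \<epsilon> (\<lambda>t. fst (modes_state (x t))) (\<lambda>t. fst (snd (snd (modes_state (x t)))))"
proof -
  define a where "a t = Re (fst (x t))" for t
  define b where "b t = Im (fst (x t))" for t
  define c where "c t = Re (snd (x t))" for t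
  define d where "d t = Im (snd (x t))" for t
  define f where "f t = mode_force1 (t, modes_state (x t))" for t
  define g where "g t = mode_force2 (t, modes_state (x t))" for t
  note fst' = bounded_linear.has_vector_derivative[OF bounded_linear_fst x]
  note snd' = bounded_linear.has_vector_derivative[OF bounded_linear_snd x]
  have a: "(a has_real_derivative omega1 * b t) (at t)" for t
    using bounded_linear.has_vector_derivative[OF bounded_linear_Re fst', of t]
    by (simp add: has_real_derivative_iff_has_vector_derivative a_def[abs_def] b_def mode_field_def)
  have b: "(b has_real_derivative - omega1 * a t + \<epsilon> / 2 * f t) (at t)" for t
    using bounded_linear.has_vector_derivative[OF bounded_linear_Im fst', of t]
    by (simp add: has_real_derivative_iff_has_vector_derivative a_def b_def[abs_def] f_def mode_field_def)
  have c: "(c has_real_derivative omega2 * d t) (at t)" for t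
    using bounded_linear.has_vector_derivative[OF bounded_linear_Re snd', of t]
    by (simp add: has_real_derivative_iff_has_vector_derivative c_def[abs_def] d_def mode_field_def)
  have d: "(d has_real_derivative - omega2 * c t + \<epsilon> / 2 * g t) (at t)" for t
    using bounded_linear.has_vector_derivative[OF bounded_linear_Im snd', of t]
    by (simp add: has_real_derivative_iff_has_vector_derivative c_def d_def[abs_def] g_def mode_field_def)
  define \<theta>1 where "\<theta>1 t = (a t / omega1 - c t / omega2) / sqrt 2" for t
  define \<theta>2 where "\<theta>2 t = a t / omega1 + c t / omega2" for t
  have \<theta>1: "(\<theta>1 has_real_derivative (b t - d t) / sqrt 2) (at t)" for t
    using DERIV_cdivide[OF DERIV_diff[OF DERIV_cdivide[OF a] DERIV_cdivide[OF c]], of omega1 omega2 "sqrt 2" t]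
    by (simp add: \<theta>1_def[abs_def])
  have \<theta>2: "(\<theta>2 has_real_derivative b t + d t) (at t)" for t
    using DERIV_add[OF DERIV_cdivide[OF a] DERIV_cdivide[OF c], of omega1 omega2 t]
    by (simp add: \<theta>2_def[abs_def])
  have deriv: "deriv \<theta>1 = (\<lambda>t. (b t - d t) / sqrt 2)" "deriv \<theta>2 = (\<lambda>t. b t + d t)"
    using \<theta>1 \<theta>2 by (auto intro!: DERIV_imp_deriv)
  have state: "modes_state (x t) = (\<theta>1 t, deriv \<theta>1 t, \<theta>2 t, deriv \<theta>2 t)" for t
    by (simp add: modes_state_def deriv \<theta>1_def \<theta>2_def a_def b_def c_def d_def)
  have aw: "omega1 * a t = (2 - sqrt 2) * (a t / omega1)" for t
    by (simp flip: omega1_square)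
  have cw: "omega2 * c t = (2 + sqrt 2) * (c t / omega2)" for t
    by (simp flip: omega2_square)
  have fg: "f t = sqrt 2 * F1 (t, modes_state (x t)) + F2 (t, modes_state (x t))"
    "g t = - sqrt 2 * F1 (t, modes_state (x t)) + F2 (t, modes_state (x t))" for t
    by (simp_all add: f_def g_def mode_force1_def mode_force2_def)
  have inv: "y / sqrt 2 = y * sqrt 2 / 2" for y
    by (rule frac_eq_eq[THEN iffD2]) auto
  \<comment> \<open>Here \<open>s\<close> is \<open>sqrt 2\<close>, \<open>u\<close> and
    \<open>z\<close> are the amplitudes \<open>a t / omega1\<close> and \<open>c t / omega2\<close>,
    and \<open>v\<close> and \<open>w\<close> are the values of \<open>F1\<close> and
    \<open>F2\<close>.\<close>
  have alg: "((- ((2 - s) * u) + e / 2 * (s * v + w)) - (- ((2 + s) * z) + e / 2 * (- s * v + w))) * s / 2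
      = - 2 * ((u - z) * s / 2) + (u + z) + e * v" if "s * s = 2" for s u v w z e :: real
  proof -
    have "((- ((2 - s) * u) + e / 2 * (s * v + w)) - (- ((2 + s) * z) + e / 2 * (- s * v + w))) * s / 2
        = (2 * s * (z - u) + s * s * (u + z + e * v)) / 2"
      by (simp add: field_simps)
    then show ?thesis
      unfolding that by (simp add: field_simps)
  qed
  have "(deriv \<theta>1 has_real_derivative
      - 2 * \<theta>1 t + \<theta>2 t + \<epsilon> * F1 (t, modes_state (x t))) (at t)" for t
  proof -
    have "(deriv \<theta>1 has_real_derivative
        ((- omega1 * a t + \<epsilon> / 2 * f t) - (- omega2 * c t + \<epsilon> / 2 * g t)) / sqrt 2) (at t)"
      unfolding deriv by (intro DERIV_cdivide DERIV_diff b d)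
    moreover have "((- omega1 * a t + \<epsilon> / 2 * f t) - (- omega2 * c t + \<epsilon> / 2 * g t)) / sqrt 2
        = - 2 * \<theta>1 t + \<theta>2 t + \<epsilon> * F1 (t, modes_state (x t))"
      unfolding mult_minus_left aw cw fg inv \<theta>1_def \<theta>2_def by (rule alg[unfolded mult_minus_left]) simp
    ultimately show ?thesis by simp
  qed
  moreover have "(deriv \<theta>2 has_real_derivative
      2 * \<theta>1 t - 2 * \<theta>2 t + \<epsilon> * F2 (t, modes_state (x t))) (at t)" for t
  proof -
    have "(deriv \<theta>2 has_real_derivative
        (- omega1 * a t + \<epsilon> / 2 * f t) + (- omega2 * c t + \<epsilon> / 2 * g t)) (at t)"
      unfolding deriv by (intro DERIV_add b d)
    moreover have "(- omega1 * a t + \<epsilon> / 2 * f t) + (- omega2 * c t + \<epsilon> / 2 * g t)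
        = 2 * \<theta>1 t - 2 * \<theta>2 t + \<epsilon> * F2 (t, modes_state (x t))"
      by (simp add: aw cw fg inv \<theta>1_def \<theta>2_def algebra_simps diff_divide_distrib)
    ultimately show ?thesis by simp
  qed
  ultimately have "pendulum_solution F1 F2 \<epsilon> \<theta>1 \<theta>2"
    using \<theta>1 \<theta>2 unfolding pendulum_solution_def state real_differentiable_def by blast
  moreover have "(\<lambda>t. fst (modes_state (x t))) = \<theta>1" "(\<lambda>t. fst (snd (snd (modes_state (x t))))) = \<theta>2"
    by (auto simp: state)
  ultimately show ?thesis by simp
qed

end

text \<open>Simplicity speaks of partial derivatives, the Newton map of a total one. The chain rule
  along the two coordinate lines identifies the partials with the values at 1 and \<i>, and Cramer's
  rule finishes.\<close>

lemma simple_zero_inj: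
  assumes zero: "simple_zero g h Z W"
    and L: "((\<lambda>b. g (Re b) (Im b)) has_derivative L) (at (Complex Z W))"
    and M: "((\<lambda>b. h (Re b) (Im b)) has_derivative M) (at (Complex Z W))"
    and eq: "L v = 0" "M v = 0"
  shows "v = 0"
proof -
  have 1: "((\<lambda>z. Complex z W) has_derivative (\<lambda>h. h *\<^sub>R 1)) (at Z)"
    unfolding Complex_eq by (auto intro!: derivative_eq_intros simp: scaleR_conv_of_real)
  have 2: "((\<lambda>w. Complex Z w) has_derivative (\<lambda>h. h *\<^sub>R \<i>)) (at W)"
    unfolding Complex_eq by (auto intro!: derivative_eq_intros simp: scaleR_conv_of_real)
  have part: "((\<lambda>z. k z W) has_real_derivative N 1) (at Z) \<and> ((\<lambda>w. k Z w) has_real_derivative N \<i>) (at W)"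
    and lin: "N v = Re v * N 1 + Im v * N \<i>"
    if N: "((\<lambda>b. k (Re b) (Im b)) has_derivative N) (at (Complex Z W))" for k :: "real \<Rightarrow> real \<Rightarrow> real" and N v
  proof -
    interpret N: linear N
      using N by (rule has_derivative_linear)
    show "((\<lambda>z. k z W) has_real_derivative N 1) (at Z) \<and> ((\<lambda>w. k Z w) has_real_derivative N \<i>) (at W)"
      using has_derivative_compose[OF 1 N] has_derivative_compose[OF 2 N]
      by (simp add: has_field_derivative_def N.scale mult.commute[of _ "N _"])
    have "v = Re v *\<^sub>R 1 + Im v *\<^sub>R \<i>"
      by (simp add: complex_eq_iff)
    then show "N v = Re v * N 1 + Im v * N \<i>"
      by (metis N.add N.scale real_scaleR_def)
  qed
  have "partials_matrix g h Z W = vector [vector [L 1, L \<i>], vector [M 1, M \<i>]]"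
    using part[OF L, THEN conjunct1, THEN DERIV_imp_deriv] part[OF L, THEN conjunct2, THEN DERIV_imp_deriv]
      part[OF M, THEN conjunct1, THEN DERIV_imp_deriv] part[OF M, THEN conjunct2, THEN DERIV_imp_deriv]
    by (simp add: partials_matrix_def)
  then have det: "L 1 * M \<i> - L \<i> * M 1 \<noteq> 0"
    using zero by (simp add: simple_zero_def det_2)
  have eqs: "Re v * L 1 + Im v * L \<i> = 0" "Re v * M 1 + Im v * M \<i> = 0"
    using lin[OF L, of v] lin[OF M, of v] eq by simp_all
  then have "Re v * (L 1 * M \<i> - L \<i> * M 1) = 0" "Im v * (L 1 * M \<i> - L \<i> * M 1) = 0"
    by algebra+
  with det show ?thesis
    by (simp add: complex_eq_iff)
qed

subsection \<open>The perturbation in rotating coordinates\<close>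

definition resonant_blinfun :: "real \<Rightarrow> complex \<Rightarrow>\<^sub>L (real \<times> real \<times> real \<times> real)" where
  "resonant_blinfun t = Blinfun (\<lambda>b. modes_state (rotate_modes t (0, b)))"

lemma resonant_blinfun_apply: "blinfun_apply (resonant_blinfun t) b = modes_state (rotate_modes t (0, b))"
  unfolding resonant_blinfun_def
  by (subst bounded_linear_Blinfun_apply)
    (auto intro!: bounded_linear_compose[OF bounded_linear_modes_state]
      bounded_linear_compose[OF bounded_linear_rotate_modes]
      bounded_linear_Pair bounded_linear_zero bounded_linear_ident)

lemma continuous_on_resonant_blinfun: "continuous_on A resonant_blinfun"
  by (intro continuous_on_blinfun_componentwise, unfold resonant_blinfun_apply)
    (intro bounded_linear.continuous_on[OF bounded_linear_modes_state] continuous_intros)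

context
  fixes F1 F2 :: perturbation
begin

text \<open>Variation of constants: pulling \<open>mode_field\<close> back along the free rotation
  removes its linear part, and the \<open>cis\<close> factors rotate the force back.\<close>

definition rotated_field :: "real \<Rightarrow> complex \<times> complex \<Rightarrow> complex \<times> complex" where
  "rotated_field t y =
    (\<i> / 2 * cis (omega1 * t) * of_real (mode_force1 F1 F2 (t, modes_state (rotate_modes t y))),
     \<i> / 2 * cis (omega2 * t) * of_real (mode_force2 F1 F2 (t, modes_state (rotate_modes t y))))"

lemma rotate_modes_has_vector_derivative:
  assumes y: "(y has_vector_derivative \<epsilon> *\<^sub>R rotated_field t (y t)) (at t within A)"
  shows "((\<lambda>t. rotate_modes t (y t)) has_vector_derivative
    mode_field F1 F2 \<epsilon> t (rotate_modes t (y t))) (at t within A)"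
proof -
  have cis: "((\<lambda>t. cis (- (w * t))) has_vector_derivative - (\<i> * of_real w) * cis (- (w * t))) (at t within A)" for w
    unfolding has_vector_derivative_def
    by (auto intro!: derivative_eq_intros simp: scaleR_conv_of_real fun_eq_iff)
  have cis_cancel: "cis (w * t) * cis (- (w * t)) = 1" for w
    by (simp add: cis_mult)
  note y1 = bounded_linear.has_vector_derivative[OF bounded_linear_fst y]
  note y2 = bounded_linear.has_vector_derivative[OF bounded_linear_snd y]
  have shape: "a * (- (\<i> * of_real w) * c) + \<epsilon> *\<^sub>R (\<i> / 2 * c' * of_real m) * c
      = \<i> * of_real (- w) * (a * c) + \<i> * of_real (\<epsilon> / 2 * m)" if "c' * c = 1" for a c c' :: complex and w m
  proof -
    have "\<epsilon> *\<^sub>R (\<i> / 2 * c' * of_real m) * c = \<i> * of_real (\<epsilon> / 2 * m) * (c' * c)"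
      by (simp add: scaleR_conv_of_real)
    then show ?thesis
      unfolding that by simp
  qed
  have "((\<lambda>t. rotate_modes t (y t)) has_vector_derivative
     (fst (y t) * (- (\<i> * of_real omega1) * cis (- (omega1 * t))) + fst (\<epsilon> *\<^sub>R rotated_field t (y t)) * cis (- (omega1 * t)),
      snd (y t) * (- (\<i> * of_real omega2) * cis (- (omega2 * t))) + snd (\<epsilon> *\<^sub>R rotated_field t (y t)) * cis (- (omega2 * t))))
     (at t within A)"
    unfolding rotate_modes_def
    by (intro has_vector_derivative_Pair has_vector_derivative_mult cis y1 y2)
  also have "(fst (y t) * (- (\<i> * of_real omega1) * cis (- (omega1 * t))) + fst (\<epsilon> *\<^sub>R rotated_field t (y t)) * cis (- (omega1 * t)),
      snd (y t) * (- (\<i> * of_real omega2) * cis (- (omega2 * t))) + snd (\<epsilon> *\<^sub>R rotated_field t (y t)) * cis (- (omega2 * t)))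
     = mode_field F1 F2 \<epsilon> t (rotate_modes t (y t))"
    unfolding rotated_field_def mode_field_def fst_scaleR snd_scaleR fst_conv snd_conv shape[OF cis_cancel]
    by (simp add: rotate_modes_def)
  finally show ?thesis .
qed

lemma G_eq:
  "G1 F1 F2 p (Re b) (Im b) = integral {0..real p * T2}
     (\<lambda>t. sin (omega2 * t) * mode_force2 F1 F2 (t, resonant_blinfun t b))"
  "G2 F1 F2 p (Re b) (Im b) = integral {0..real p * T2}
     (\<lambda>t. cos (omega2 * t) * mode_force2 F1 F2 (t, resonant_blinfun t b))"
  by (simp_all add: G1_def G2_def mode_force2_def along_mode2_def resonant_blinfun_apply
      modes_state_rotate_resonant)

context
  assumes smooth: "smooth F1" "smooth F2"
begin

lemma C1_mode_force: "C1 (mode_force1 F1 F2)" "C1 (mode_force2 F1 F2)"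
  using smooth unfolding mode_force1_def[abs_def] mode_force2_def[abs_def]
  by (intro C1_linear_combination smooth_imp_C1; simp)+

lemma continuous_on_mode_force:
  assumes "continuous_on A f"
  shows "continuous_on A (\<lambda>x. mode_force1 F1 F2 (f x))" "continuous_on A (\<lambda>x. mode_force2 F1 F2 (f x))"
  using C1_mode_force[THEN C1_imp_continuous_on, of UNIV] assms
  by (auto intro: continuous_on_compose2)

lemma continuous_on_rotated_field:
  "continuous_on A (\<lambda>(t, y). rotated_field t y)"
  unfolding rotated_field_def split_beta
  by (intro continuous_intros continuous_on_mode_force
      bounded_linear.continuous_on[OF bounded_linear_modes_state])

text \<open>The force is only locally Lipschitz. Since rotations are isometries, the states arising
  from one ball stay in one ball for all \<open>t\<close>, so constants on the compact convex set
  \<open>A\<close> serve the whole time interval.\<close>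

lemma rotated_field_lipschitz:
  obtains K where "\<And>t y z. \<lbrakk>t \<in> {0..T}; y \<in> cball c r; z \<in> cball c r\<rbrakk>
    \<Longrightarrow> norm (rotated_field t y - rotated_field t z) \<le> K * norm (y - z)"
proof -
  interpret ms: bounded_linear modes_state by (rule bounded_linear_modes_state)
  obtain C where C: "C > 0" "\<And>x. norm (modes_state x) \<le> norm x * C"
    using ms.pos_bounded by blast
  define A where "A = {0..T} \<times> cball (0 :: real \<times> real \<times> real \<times> real) ((norm c + r) * C)"
  have A: "compact A" "convex A"
    by (auto simp: A_def intro: compact_Times convex_Times)
  obtain K1 where K1: "K1 \<ge> 0" "\<And>x y. \<lbrakk>x \<in> A; y \<in> A\<rbrakk> \<Longrightarrow>
      norm (mode_force1 F1 F2 x - mode_force1 F1 F2 y) \<le> K1 * norm (x - y)"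
    by (rule C1_lipschitz_compact[OF C1_mode_force(1) A]) blast
  obtain K2 where K2: "K2 \<ge> 0" "\<And>x y. \<lbrakk>x \<in> A; y \<in> A\<rbrakk> \<Longrightarrow>
      norm (mode_force2 F1 F2 x - mode_force2 F1 F2 y) \<le> K2 * norm (x - y)"
    by (rule C1_lipschitz_compact[OF C1_mode_force(2) A]) blast
  show thesis
  proof (rule that[of "1 / 2 * (K1 * C) + 1 / 2 * (K2 * C)"])
    fix t y z
    assume t: "t \<in> {0..T}" and y: "y \<in> cball c r" and z: "z \<in> cball c r"
    interpret rot: bounded_linear "rotate_modes t" by (rule bounded_linear_rotate_modes)
    define s where "s y = (t, modes_state (rotate_modes t y))" for y
    have s_A: "s x \<in> A" if "x \<in> cball c r" for x
    proof -
      have "norm x \<le> norm c + r"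
        using that norm_triangle_sub[of x c] by (simp add: dist_norm norm_minus_commute)
      then have "norm (modes_state (rotate_modes t x)) \<le> (norm c + r) * C"
        using order_trans[OF C(2)[of "rotate_modes t x"]] mult_right_mono[OF _ less_imp_le[OF C(1)]]
        by simp
      with t show ?thesis by (simp add: A_def s_def)
    qed
    have s_diff: "norm (s y - s z) \<le> C * norm (y - z)"
      using C(2)[of "rotate_modes t (y - z)"]
      by (simp add: s_def norm_Pair ms.diff rot.diff mult.commute flip: ms.diff rot.diff)
    have norm_force: "norm (\<i> / 2 * cis w * of_real u - \<i> / 2 * cis w * of_real v) = 1 / 2 * norm (u - v)" for w u v :: real
      by (simp only: right_diff_distrib[symmetric] of_real_diff[symmetric]) (simp add: norm_mult norm_divide del: of_real_diff)
    have "norm (fst (rotated_field t y - rotated_field t z)) = 1 / 2 * norm (mode_force1 F1 F2 (s y) - mode_force1 F1 F2 (s z))"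
      by (simp only: rotated_field_def fst_diff snd_diff fst_conv snd_conv s_def norm_force)
    also have "\<dots> \<le> 1 / 2 * (K1 * (C * norm (y - z)))"
      using K1(2)[OF s_A[OF y] s_A[OF z]] mult_left_mono[OF s_diff K1(1)] by simp
    finally have 1: "norm (fst (rotated_field t y - rotated_field t z)) \<le> 1 / 2 * (K1 * (C * norm (y - z)))" .
    have "norm (snd (rotated_field t y - rotated_field t z)) = 1 / 2 * norm (mode_force2 F1 F2 (s y) - mode_force2 F1 F2 (s z))"
      by (simp only: rotated_field_def fst_diff snd_diff fst_conv snd_conv s_def norm_force)
    also have "\<dots> \<le> 1 / 2 * (K2 * (C * norm (y - z)))"
      using K2(2)[OF s_A[OF y] s_A[OF z]] mult_left_mono[OF s_diff K2(1)] by simp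
    finally have 2: "norm (snd (rotated_field t y - rotated_field t z)) \<le> 1 / 2 * (K2 * (C * norm (y - z)))" .
    have "norm (rotated_field t y - rotated_field t z)
        \<le> norm (fst (rotated_field t y - rotated_field t z)) + norm (snd (rotated_field t y - rotated_field t z))"
      using norm_Pair_le[of "fst (rotated_field t y - rotated_field t z)" "snd (rotated_field t y - rotated_field t z)"]
      by (simp del: fst_diff snd_diff)
    with 1 2 show "norm (rotated_field t y - rotated_field t z)
        \<le> (1 / 2 * (K1 * C) + 1 / 2 * (K2 * C)) * norm (y - z)"
      by (simp add: algebra_simps del: fst_diff snd_diff)
  qed
qed

lemma G_differentiable:
  "\<exists>L. ((\<lambda>b. G1 F1 F2 p (Re b) (Im b)) has_derivative L) (at b)"
  "\<exists>L. ((\<lambda>b. G2 F1 F2 p (Re b) (Im b)) has_derivative L) (at b)"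
  unfolding G_eq
  by (intro parametric_integral_has_derivative C1_mode_force continuous_on_resonant_blinfun continuous_intros)+

text \<open>Euler's formula for \<open>cis (omega2 * t)\<close>: the cosine part integrates to
  \<open>G2\<close>, the sine part to \<open>G1\<close>.\<close>

lemma averaged_field:
  "integral {0..real p * T2} (\<lambda>t. snd (rotated_field t (0, b))) =
    \<i> / 2 * (of_real (G2 F1 F2 p (Re b) (Im b)) + \<i> * of_real (G1 F1 F2 p (Re b) (Im b)))"
proof -
  define m where "m t = mode_force2 F1 F2 (t, resonant_blinfun t b)" for t
  have m: "continuous_on A m" for A
    unfolding m_def[abs_def] resonant_blinfun_apply
    by (intro continuous_on_mode_force bounded_linear.continuous_on[OF bounded_linear_modes_state] continuous_intros)
  have "((\<lambda>t. \<i> / 2 * (of_real (cos (omega2 * t) * m t) + \<i> * of_real (sin (omega2 * t) * m t))) has_integral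
      \<i> / 2 * (of_real (G2 F1 F2 p (Re b) (Im b)) + \<i> * of_real (G1 F1 F2 p (Re b) (Im b)))) {0..real p * T2}"
    unfolding G_eq m_def[symmetric]
    by (intro has_integral_mult_right has_integral_add has_integral_of_real integrable_integral
        integrable_continuous_real continuous_intros m)
  moreover have "\<i> / 2 * (of_real (cos (omega2 * t) * m t) + \<i> * of_real (sin (omega2 * t) * m t))
      = snd (rotated_field t (0, b))" for t
    by (simp add: rotated_field_def m_def resonant_blinfun_apply complex_eq_iff)
  ultimately show ?thesis
    by (simp add: integral_unique)
qed

end

end

subsection \<open>Periodic solutions\<close>

lemma periodic_fun_simple_of_nat:
  assumes "periodic_fun_simple f P"
  shows "periodic_fun_simple f (real n * P)"
proof -
  interpret periodic_fun_simple f P by fact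
  show ?thesis by standard (rule plus_of_nat)
qed

text \<open>A single \<open>s\<close> serves all functions of period \<open>P\<close>, so an
  estimate comparing a solution with its target moves from one period to the whole line.\<close>

lemma periodic_fun_simple_shift:
  fixes P :: real
  assumes "P > 0"
  obtains s where "s \<in> {0..P}" and "\<And>f. periodic_fun_simple f P \<Longrightarrow> f t = f s"
proof
  define k where "k = \<lfloor>t / P\<rfloor>"
  show "t - of_int k * P \<in> {0..P}"
    using floor_divide_lower[OF assms, of t] floor_divide_upper[OF assms, of t]
    by (auto simp: k_def algebra_simps)
  show "f t = f (t - of_int k * P)" if "periodic_fun_simple f P" for f
  proof -
    interpret periodic_fun_simple f P by fact
    show ?thesis by (rule minus_of_int[symmetric])
  qed
qed

lemma mode2_periodic: "periodic_fun_simple (A2 Z W) T2" "periodic_fun_simple (C2 Z W) T2"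
  by (simp_all add: periodic_fun_simple_def A2_def C2_def distrib_left omega2_T2)

text \<open>At \<epsilon> = 0 the rotated equation is \<open>y' = 0\<close>, and a constant with
  vanishing first mode gives the target.\<close>

lemma mode2_solution: "pendulum_solution F1 F2 0 (A2 Z W) (C2 Z W)"
proof -
  have "((\<lambda>t. rotate_modes t (0, Complex Z W)) has_vector_derivative
      mode_field F1 F2 0 t (rotate_modes t (0, Complex Z W))) (at t)" for t
    by (rule rotate_modes_has_vector_derivative[where y = "\<lambda>t. (0, Complex Z W)"]) auto
  from mode_solution[OF this] show ?thesis
    by (simp add: modes_state_rotate_resonant)
qed

text \<open>The radius \<open>r\<close> is fixed before \<epsilon>, as Brouwer's theorem offers no
  coherent choice across different \<epsilon>; \<open>near_optimal_selection\<close> assembles one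
  afterwards.\<close>

lemma periodic_branch:
  assumes p: "p > 0" and smooth: "smooth F1" "smooth F2"
    and per: "\<And>x. periodic_fun_simple (\<lambda>\<tau>. F1 (\<tau>, x)) (real p * T2)"
      "\<And>x. periodic_fun_simple (\<lambda>\<tau>. F2 (\<tau>, x)) (real p * T2)"
    and zero: "simple_zero (G1 F1 F2 p) (G2 F1 F2 p) Z W"
    and r: "r > 0"
  shows "\<forall>\<^sub>F \<epsilon> in at 0. \<exists>\<theta>1 \<theta>2. pendulum_solution F1 F2 \<epsilon> \<theta>1 \<theta>2 \<and>
    periodic_fun_simple \<theta>1 (real p * T2) \<and> periodic_fun_simple \<theta>2 (real p * T2) \<and>
    (\<forall>\<tau>. \<bar>\<theta>1 \<tau> - A2 Z W \<tau>\<bar> \<le> r \<and> \<bar>\<theta>2 \<tau> - C2 Z W \<tau>\<bar> \<le> r)"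
proof -
  define T where "T = real p * T2"
  define b where "b = Complex Z W"
  define c where "c = cis (omega1 * T)"
  have T: "T > 0" using p by (simp add: T_def)
  have c: "c \<noteq> 1" using cis_omega1_period[OF p] by (simp add: c_def T_def)
  interpret ms: bounded_linear modes_state by (rule bounded_linear_modes_state)
  obtain C where C: "C > 0" "\<And>x. norm (modes_state x) \<le> norm x * C"
    using ms.pos_bounded by blast
  obtain K where K: "\<And>t y z. \<lbrakk>t \<in> {0..T}; y \<in> cball (0, b) 1; z \<in> cball (0, b) 1\<rbrakk>
      \<Longrightarrow> norm (rotated_field F1 F2 t y - rotated_field F1 F2 t z) \<le> K * norm (y - z)"
    by (rule rotated_field_lipschitz[OF smooth]) blast
  obtain L1 where L1: "((\<lambda>b. G1 F1 F2 p (Re b) (Im b)) has_derivative L1) (at b)"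
    using G_differentiable(1)[OF smooth] by blast
  obtain L2 where L2: "((\<lambda>b. G2 F1 F2 p (Re b) (Im b)) has_derivative L2) (at b)"
    using G_differentiable(2)[OF smooth] by blast
  define L where "L v = \<i> / 2 * (of_real (L2 v) + \<i> * of_real (L1 v))" for v
  have L: "((\<lambda>b. integral {0..T} (\<lambda>t. snd (rotated_field F1 F2 t (0, b)))) has_derivative L) (at b)"
    unfolding T_def averaged_field[OF smooth] L_def[abs_def]
    by (intro has_derivative_mult_right has_derivative_add has_derivative_of_real L1 L2)
  have "linear L"
    using L by (rule has_derivative_linear)
  moreover have "v = 0" if "L v = 0" for v
  proof (rule simple_zero_inj[OF zero L1[unfolded b_def] L2[unfolded b_def]])
    show "L1 v = 0" "L2 v = 0"
      using that by (auto simp: L_def complex_eq_iff)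
  qed
  ultimately have "inj L"
    by (auto simp: linear_injective_0)
  have avg_0: "integral {0..T} (\<lambda>t. snd (rotated_field F1 F2 t (0, b))) = 0"
    using zero by (simp add: T_def averaged_field[OF smooth] b_def simple_zero_def)
  \<comment> \<open>Here \<open>R\<close> is multiplication by \<open>c\<close>, so nonresonance of
    the first mode is exactly what makes division by \<open>c - 1\<close> a right inverse of
    \<open>R - 1\<close>.\<close>
  have S: "bounded_linear (\<lambda>a. a / (c - 1))"
    by (rule bounded_linear_divide)
  have S_inv: "a / (c - 1) * c - a / (c - 1) = a" for a
    using c by (simp add: divide_simps) (simp add: algebra_simps)
  have "r / C > 0" using r C by simp
  then have "\<forall>\<^sub>F \<epsilon> in at 0. \<exists>y.
      (\<forall>t\<in>{0..T}. (y has_vector_derivative \<epsilon> *\<^sub>R rotated_field F1 F2 t (y t)) (at t within {0..T})) \<and>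
      y T = (fst (y 0) * c, snd (y 0)) \<and> (\<forall>t\<in>{0..T}. norm (y t - (0, b)) \<le> r / C)"
    using averaging[OF less_imp_le[OF T] continuous_on_rotated_field[OF smooth] _ S S_inv avg_0 L \<open>inj L\<close>] K
    by blast
  then show ?thesis
  proof (rule eventually_mono, elim exE conjE)
    fix \<epsilon> y
    assume y: "\<forall>t\<in>{0..T}. (y has_vector_derivative \<epsilon> *\<^sub>R rotated_field F1 F2 t (y t)) (at t within {0..T})"
      and y_T: "y T = (fst (y 0) * c, snd (y 0))"
      and near: "\<forall>t\<in>{0..T}. norm (y t - (0, b)) \<le> r / C"
    have field_per: "periodic_fun_simple (\<lambda>t. mode_field F1 F2 \<epsilon> t x) T" for x
      by standard (simp add: mode_field_def mode_force1_def mode_force2_def T_def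
          periodic_fun_simple.plus_period[OF per(1)] periodic_fun_simple.plus_period[OF per(2)])
    \<comment> \<open>The factor \<open>c\<close> in the boundary condition is the one that the
      rotation of the first mode cancels at time \<open>T\<close>; the second mode completes
      \<open>p\<close> full turns.\<close>
    have closed: "rotate_modes T (y T) = rotate_modes 0 (y 0)"
    proof -
      have "c * cis (- (omega1 * T)) = 1" "cis (- (omega2 * T)) = 1"
        using cis_omega2_period[of p] by (simp_all add: c_def T_def cis_mult flip: cis_inverse)
      then show ?thesis
        by (simp add: rotate_modes_def y_T mult.assoc)
    qed
    obtain U where U: "\<And>t. (U has_vector_derivative mode_field F1 F2 \<epsilon> t (U t)) (at t)"
      and U_per: "periodic_fun_simple U T"
      and U_eq: "\<And>t. t \<in> {0..T} \<Longrightarrow> U t = rotate_modes t (y t)"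
    proof (rule periodic_extension[OF T, of "\<lambda>t. rotate_modes t (y t)" "mode_field F1 F2 \<epsilon>"])
      show "((\<lambda>t. rotate_modes t (y t)) has_vector_derivative mode_field F1 F2 \<epsilon> t (rotate_modes t (y t)))
          (at t within {0..T})" if "t \<in> {0..T}" for t
        using y that by (intro rotate_modes_has_vector_derivative) auto
    qed (use closed field_per in auto)
    define \<theta>1 where "\<theta>1 t = fst (modes_state (U t))" for t
    define \<theta>2 where "\<theta>2 t = fst (snd (snd (modes_state (U t))))" for t
    have per_\<theta>: "periodic_fun_simple \<theta>1 T" "periodic_fun_simple \<theta>2 T"
      using periodic_fun_simple.plus_period[OF U_per]
      by (simp_all add: periodic_fun_simple_def \<theta>1_def \<theta>2_def)
    have near_0: "\<bar>\<theta>1 t - A2 Z W t\<bar> \<le> r \<and> \<bar>\<theta>2 t - C2 Z W t\<bar> \<le> r" if t: "t \<in> {0..T}" for t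
    proof -
      interpret rot: bounded_linear "rotate_modes t" by (rule bounded_linear_rotate_modes)
      define d where "d = modes_state (rotate_modes t (y t - (0, b)))"
      have "norm d \<le> norm (y t - (0, b)) * C"
        using C(2)[of "rotate_modes t (y t - (0, b))"] by (simp add: d_def)
      also have "\<dots> \<le> r"
        using near t C(1) by (simp add: field_simps)
      finally have "norm d \<le> r" .
      moreover have "norm (fst d) \<le> norm d" "norm (snd d) \<le> norm d"
        "norm (snd (snd d)) \<le> norm (snd d)" "norm (fst (snd (snd d))) \<le> norm (snd (snd d))"
        using norm_fst_le[of "fst d" "snd d"] norm_snd_le[of "snd d" "fst d"]
          norm_snd_le[of "snd (snd d)" "fst (snd d)"] norm_fst_le[of "fst (snd (snd d))" "snd (snd (snd d))"]
        by simp_all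
      moreover have "d = modes_state (U t) - modes_state (rotate_modes t (0, b))"
        by (simp add: d_def ms.diff rot.diff U_eq[OF t])
      then have "fst d = \<theta>1 t - A2 Z W t" "fst (snd (snd d)) = \<theta>2 t - C2 Z W t"
        by (simp_all add: \<theta>1_def \<theta>2_def modes_state_rotate_resonant b_def)
      ultimately show ?thesis
        by simp
    qed
    have "\<bar>\<theta>1 t - A2 Z W t\<bar> \<le> r \<and> \<bar>\<theta>2 t - C2 Z W t\<bar> \<le> r" for t
    proof -
      obtain s where s: "s \<in> {0..T}" and eq: "\<And>f :: real \<Rightarrow> real. periodic_fun_simple f T \<Longrightarrow> f t = f s"
        by (rule periodic_fun_simple_shift[OF T]) blast
      show ?thesis
        using near_0[OF s] eq[OF per_\<theta>(1)] eq[OF per_\<theta>(2)]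
          eq[OF periodic_fun_simple_of_nat[OF mode2_periodic(1), where n = p, folded T_def]]
          eq[OF periodic_fun_simple_of_nat[OF mode2_periodic(2), where n = p, folded T_def]]
        by simp
    qed
    moreover have "pendulum_solution F1 F2 \<epsilon> \<theta>1 \<theta>2"
      using mode_solution[OF U] by (simp add: \<theta>1_def[abs_def] \<theta>2_def[abs_def])
    ultimately show "\<exists>\<theta>1 \<theta>2. pendulum_solution F1 F2 \<epsilon> \<theta>1 \<theta>2 \<and>
        periodic_fun_simple \<theta>1 (real p * T2) \<and> periodic_fun_simple \<theta>2 (real p * T2) \<and>
        (\<forall>\<tau>. \<bar>\<theta>1 \<tau> - A2 Z W \<tau>\<bar> \<le> r \<and> \<bar>\<theta>2 \<tau> - C2 Z W \<tau>\<bar> \<le> r)"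
      using per_\<theta> unfolding T_def by blast
  qed
qed

theorem theorem3:
  fixes p q :: nat
    and F1 F2 :: "real \<times> real \<times> real \<times> real \<times> real \<Rightarrow> real"
  assumes "p > 0" and "q > 0" and "coprime p q"
    and "smooth F1" and "smooth F2"
    and "\<And>x. periodic_fun_simple (\<lambda>\<tau>. F1 (\<tau>, x)) (real p * T2 / real q)"
    and "\<And>x. periodic_fun_simple (\<lambda>\<tau>. F2 (\<tau>, x)) (real p * T2 / real q)"
  shows "\<exists>\<epsilon>0>0. \<forall>Z W. simple_zero (G1 F1 F2 p) (G2 F1 F2 p) Z W \<and> (Z, W) \<noteq> (0, 0) \<longrightarrow>
    pendulum_solution F1 F2 0 (A2 Z W) (C2 Z W) \<and>
    periodic_fun_simple (A2 Z W) T2 \<and> periodic_fun_simple (C2 Z W) T2 \<and>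
    (\<exists>\<theta>1 \<theta>2 :: real \<Rightarrow> real \<Rightarrow> real.
      (\<forall>\<epsilon>. \<epsilon> \<noteq> 0 \<and> \<bar>\<epsilon>\<bar> < \<epsilon>0 \<longrightarrow>
        pendulum_solution F1 F2 \<epsilon> (\<lambda>\<tau>. \<theta>1 \<tau> \<epsilon>) (\<lambda>\<tau>. \<theta>2 \<tau> \<epsilon>) \<and>
        periodic_fun_simple (\<lambda>\<tau>. \<theta>1 \<tau> \<epsilon>) (real p * T2) \<and>
        periodic_fun_simple (\<lambda>\<tau>. \<theta>2 \<tau> \<epsilon>) (real p * T2)) \<and>
      (\<forall>\<tau>. ((\<lambda>\<epsilon>. \<theta>1 \<tau> \<epsilon>) \<longlongrightarrow> A2 Z W \<tau>) (at 0) \<and>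
           ((\<lambda>\<epsilon>. \<theta>2 \<tau> \<epsilon>) \<longlongrightarrow> C2 Z W \<tau>) (at 0)))"
proof -
  let ?T = "real p * T2"
  define P where "P \<epsilon> \<theta> \<longleftrightarrow> pendulum_solution F1 F2 \<epsilon> (fst \<theta>) (snd \<theta>) \<and>
    periodic_fun_simple (fst \<theta>) ?T \<and> periodic_fun_simple (snd \<theta>) ?T" for \<epsilon> \<theta>
  define Q where "Q Z W \<theta> r \<longleftrightarrow> (\<forall>\<tau>. \<bar>fst \<theta> \<tau> - A2 Z W \<tau>\<bar> \<le> r \<and> \<bar>snd \<theta> \<tau> - C2 Z W \<tau>\<bar> \<le> r)" for Z W \<theta> r
  have per: "periodic_fun_simple (\<lambda>\<tau>. F1 (\<tau>, x)) ?T" "periodic_fun_simple (\<lambda>\<tau>. F2 (\<tau>, x)) ?T" for x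
    using periodic_fun_simple_of_nat[OF assms(6), of x q] periodic_fun_simple_of_nat[OF assms(7), of x q] assms(2)
    by simp_all
  have branch: "\<forall>\<^sub>F \<epsilon> in at 0. \<exists>\<theta>. P \<epsilon> \<theta> \<and> Q Z W \<theta> r"
    if "simple_zero (G1 F1 F2 p) (G2 F1 F2 p) Z W" "r > 0" for Z W r
    using periodic_branch[OF assms(1,4,5) per that] by (simp add: P_def Q_def)
  \<comment> \<open>Since \<open>P\<close> does not mention the zero, the branch of any one zero
    provides periodic solutions for all small \<epsilon>. They serve the other zeros as a fallback
    where their own branches are not yet available.\<close>
  have "\<exists>\<epsilon>0>0. \<forall>Z W. simple_zero (G1 F1 F2 p) (G2 F1 F2 p) Z W \<longrightarrow> (\<forall>\<epsilon>. \<epsilon> \<noteq> 0 \<and> \<bar>\<epsilon>\<bar> < \<epsilon>0 \<longrightarrow> (\<exists>\<theta>. P \<epsilon> \<theta>))"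
  proof (cases "\<exists>Z W. simple_zero (G1 F1 F2 p) (G2 F1 F2 p) Z W")
    case True
    then obtain Z W where "simple_zero (G1 F1 F2 p) (G2 F1 F2 p) Z W" by blast
    from branch[OF this zero_less_one] obtain \<epsilon>0 where "\<epsilon>0 > 0"
      "\<And>\<epsilon>. \<lbrakk>\<epsilon> \<noteq> 0; \<bar>\<epsilon>\<bar> < \<epsilon>0\<rbrakk> \<Longrightarrow> \<exists>\<theta>. P \<epsilon> \<theta> \<and> Q Z W \<theta> 1"
      by (auto simp: eventually_at dist_real_def)
    then show ?thesis by blast
  next
    case False
    then show ?thesis by (intro exI[of _ 1]) auto
  qed
  then obtain \<epsilon>0 where \<epsilon>0: "\<epsilon>0 > 0" and ex: "\<And>Z W \<epsilon>. \<lbrakk>simple_zero (G1 F1 F2 p) (G2 F1 F2 p) Z W;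
      \<epsilon> \<noteq> 0; \<bar>\<epsilon>\<bar> < \<epsilon>0\<rbrakk> \<Longrightarrow> \<exists>\<theta>. P \<epsilon> \<theta>"
    by blast
  show ?thesis
  proof (intro exI[of _ \<epsilon>0] conjI \<epsilon>0 allI impI mode2_solution mode2_periodic)
    fix Z W
    assume "simple_zero (G1 F1 F2 p) (G2 F1 F2 p) Z W \<and> (Z, W) \<noteq> (0, 0)"
    then have zero: "simple_zero (G1 F1 F2 p) (G2 F1 F2 p) Z W" by simp
    obtain \<theta> where \<theta>: "\<And>\<epsilon>. \<lbrakk>\<epsilon> \<noteq> 0; \<bar>\<epsilon>\<bar> < \<epsilon>0\<rbrakk> \<Longrightarrow> P \<epsilon> (\<theta> \<epsilon>)"
      and near: "\<And>r. r > 0 \<Longrightarrow> \<forall>\<^sub>F \<epsilon> in at 0. Q Z W (\<theta> \<epsilon>) r"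
      by (rule near_optimal_selection[of \<epsilon>0 P "Q Z W"])
        (use ex[OF zero] branch[OF zero] in \<open>auto simp: Q_def intro: order_trans\<close>)
    have "((\<lambda>\<epsilon>. fst (\<theta> \<epsilon>) \<tau>) \<longlongrightarrow> A2 Z W \<tau>) (at 0) \<and> ((\<lambda>\<epsilon>. snd (\<theta> \<epsilon>) \<tau>) \<longlongrightarrow> C2 Z W \<tau>) (at 0)" for \<tau>
    proof (intro conjI tendstoI)
      fix e :: real assume "e > 0"
      then have "e / 2 > 0" by simp
      from near[OF this] show "\<forall>\<^sub>F \<epsilon> in at 0. dist (fst (\<theta> \<epsilon>) \<tau>) (A2 Z W \<tau>) < e"
        by eventually_elim (use \<open>e > 0\<close> in \<open>auto simp: Q_def dist_real_def dest!: spec[of _ \<tau>]\<close>)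
      from near[OF \<open>e / 2 > 0\<close>] show "\<forall>\<^sub>F \<epsilon> in at 0. dist (snd (\<theta> \<epsilon>) \<tau>) (C2 Z W \<tau>) < e"
        by eventually_elim (use \<open>e > 0\<close> in \<open>auto simp: Q_def dist_real_def dest!: spec[of _ \<tau>]\<close>)
    qed
    with \<theta> show "\<exists>\<theta>1 \<theta>2 :: real \<Rightarrow> real \<Rightarrow> real.
      (\<forall>\<epsilon>. \<epsilon> \<noteq> 0 \<and> \<bar>\<epsilon>\<bar> < \<epsilon>0 \<longrightarrow>
        pendulum_solution F1 F2 \<epsilon> (\<lambda>\<tau>. \<theta>1 \<tau> \<epsilon>) (\<lambda>\<tau>. \<theta>2 \<tau> \<epsilon>) \<and>
        periodic_fun_simple (\<lambda>\<tau>. \<theta>1 \<tau> \<epsilon>) (real p * T2) \<and>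
        periodic_fun_simple (\<lambda>\<tau>. \<theta>2 \<tau> \<epsilon>) (real p * T2)) \<and>
      (\<forall>\<tau>. ((\<lambda>\<epsilon>. \<theta>1 \<tau> \<epsilon>) \<longlongrightarrow> A2 Z W \<tau>) (at 0) \<and>
           ((\<lambda>\<epsilon>. \<theta>2 \<tau> \<epsilon>) \<longlongrightarrow> C2 Z W \<tau>) (at 0))"
      by (intro exI[of _ "\<lambda>\<tau> \<epsilon>. fst (\<theta> \<epsilon>) \<tau>"] exI[of _ "\<lambda>\<tau> \<epsilon>. snd (\<theta> \<epsilon>) \<tau>"]) (auto simp: P_def)
  qed
qed

end
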